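(* Let $F^n=(M,F)$ be a Finsler space and $i:\check M\to M$ an immersed $m$-dimensional manifold ($1<m<n$). Let $\mathring N$ be the intrinsic Cartan nonlinear connection and $\check N$ the nonlinear connection induced on $\widetilde{Osc\check M}$ by the Cartan nonlinear connection $N$ of $F^n$. Set $$D^\alpha{}_\beta=g_{\bar\alpha}{}^{\alpha}{}_{\beta}\,K^{\bar\alpha}_\gamma v^\gamma .$$ Then: 1. The coefficients of the nonlinear connections are related by $\mathring N^\alpha{}_\beta=\check N^\alpha{}_\beta+D^\alpha{}_\beta$. 2. The adapted bases $\{\mathring\delta_\alpha,\mathring\partial_{1\alpha}\}$ of $\mathring N$ and $\{\delta_\alpha,\dot\partial_{1\alpha}\}$ of $\check N$ are related by $\mathring\delta_\alpha=\delta_\alpha-D^\beta{}_\alpha\dot\partial_{1\beta}$ and $\mathring\partial_{1\alpha}=\dot\partial_{1\alpha}$. 3. The coefficients of the Lie brackets of the adapted bases of $\mathring N$ and $\check N$ are related by $$\mathring R^\alpha_{\beta\gamma}=R^\alpha_{\beta\gamma}+D_{00}{}^\alpha_{\beta\gamma},\qquad \mathring B^\alpha_{\beta\gamma}=B^\alpha_{\beta\gamma}+D_{01}{}^\alpha_{\beta\gamma},$$ where $$D_{00}{}^\alpha_{\beta\gamma}=\delta_\gamma D^\alpha{}_\beta-\delta_\beta D^\alpha{}_\gamma+D^\delta{}_\beta\,\dot\partial_{1\delta}\left(\check N^\alpha{}_\gamma+D^\alpha{}_\gamma\right)-D^\delta{}_\gamma\,\dot\partial_{1\delta}\left(\check N^\alpha{}_\beta+D^\alpha{}_\beta\right),$$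 $$D_{01}{}^\alpha_{\beta\gamma}=\dot\partial_{1\gamma}D^\alpha{}_\beta .$$
   Context: Summation convention throughout. Indices $a,b,c$ run over $1,\dots,n$; $\alpha,\beta,\gamma,\delta,\sigma$ over $1,\dots,m$; barred indices over $1,\dots,n-m$. Ambient space. $M$ is a real $n$-manifold, $OscM=TM$ with local coordinates $(x^a,y^a)$, $\widetilde{OscM}=TM\setminus\{0\}$. $F$ is a Finsler fundamental function on $M$ (smooth on $\widetilde{OscM}$, continuous on the null section), $g_{ab}=\frac12\frac{\partial^2F^2}{\partial y^a\partial y^b}$, $\gamma^a_{bc}(x,y)$ are the Christoffel symbols of $g_{ab}(x,y)$ (formed with $x$-derivatives), $G^a=\frac12\gamma^a_{bc}y^by^c$, and $N^a{}_b=\partial G^a/\partial y^b$ is the Cartan nonlinear connection of $F^n$. Put $g_{abc}=\frac12\,\partial g_{ab}/\partial y^c$. Submanifold. $i$ is locally $x^a=x^a(u^1,\dots,u^m)$ with $B^a_\alpha=\partial x^a/\partial u^\alpha$ of rank $m$; $Osc\check M=T\check M$ with coordinates $(u^\alpha,v^\alpha)$ is immersed in $OscM$ by $x^a=x^a(u)$, $y^a=B^a_\alpha v^\alpha$; $\widetilde{Osc\check M}=T\check M\setminus\{0\}$. The induced fundamental function is $\check F(u,v)=F(x(u),y(u,v))$, and $g_{\alpha\beta}(u,v)=g_{ab}B^a_\alpha B^b_\beta$ is the induced fundamental tensor, with inverse $g^{\alpha\beta}$. Along the submanifold there is a local moving frame $\{B^a_\alpha(u),B^a_{\bar\alpha}(u,v)\}$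 with dual frame $\{B^\alpha_a(u,v),B^{\bar\alpha}_a(u,v)\}$: $B^a_\beta B^\alpha_a=\delta^\alpha_\beta$, $B^a_\beta B^{\bar\alpha}_a=0$, $B^\alpha_aB^a_{\bar\beta}=0$, $B^{\bar\alpha}_aB^a_{\bar\beta}=\delta^{\bar\alpha}_{\bar\beta}$, $B^a_\alpha B^\alpha_b+B^a_{\bar\alpha}B^{\bar\alpha}_b=\delta^a_b$. Put $B^a_{\alpha\beta}=\partial^2x^a/\partial u^\alpha\partial u^\beta$, $B^a_{0\beta}=B^a_{\alpha\beta}v^\alpha$, $K^{\bar\alpha}_\beta=B^{\bar\alpha}_a(B^a_{0\beta}+N^a{}_bB^b_\beta)$, and $g_{\bar\alpha}{}^\alpha{}_\beta=g^{\alpha\gamma}g_{abc}B^a_{\bar\alpha}B^b_\gamma B^c_\beta$. All ambient functions are evaluated along the submanifold. The induced nonlinear connection is $\check N^\alpha{}_\beta=B^\alpha_a(B^a_{0\beta}+N^a{}_bB^b_\beta)$. The intrinsic Cartan nonlinear connection is $\mathring N^\alpha{}_\beta=\partial G^\alpha/\partial v^\beta$ with $G^\alpha=\frac12\gamma^\alpha_{\beta\gamma}(u,v)v^\beta v^\gamma$, $\gamma^\alpha_{\beta\gamma}$ being the Christoffel symbols of $g_{\alpha\beta}(u,v)$ (formed with $u$-derivatives). Adapted bases: $\dot\partial_{1\alpha}=\partial/\partial v^\alpha$ and $\delta_\alpha=\partial/\partial u^\alpha-\check N^\beta{}_\alpha\dot\partial_{1\beta}$ for $\check N$; $\mathring\partial_{1\alpha}=\partial/\partial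 v^\alpha$ and $\mathring\delta_\alpha=\partial/\partial u^\alpha-\mathring N^\beta{}_\alpha\dot\partial_{1\beta}$ for $\mathring N$. Coefficients of the Lie brackets: $[\delta_\alpha,\delta_\beta]=-R^\sigma_{\alpha\beta}\dot\partial_{1\sigma}$, $[\delta_\alpha,\dot\partial_{1\beta}]=B^\sigma_{\alpha\beta}\dot\partial_{1\sigma}$, $[\dot\partial_{1\alpha},\dot\partial_{1\beta}]=0$, where $R^\sigma_{\alpha\beta}=\delta_\alpha\check N^\sigma{}_\beta-\delta_\beta\check N^\sigma{}_\alpha$ and $B^\sigma_{\alpha\beta}=\dot\partial_{1\beta}\check N^\sigma{}_\alpha$; $\mathring R,\mathring B$ are defined in the same way from $\mathring N$ and $\mathring\delta_\alpha$.
   Formalization: R is taken with opposite sign, [δ_α,δ_β] = +R^σ_{αβ}∂_σ (with the stated convention the first formula of part 3 is false: it would read R̊ = R − D_00), and the frame vectors B_ᾱ are assumed g-normal to the submanifold (otherwise part 1 fails). *)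

theory Defs
  imports "HOL-Analysis.Analysis"
begin

section \<open>Smooth maps, manifolds and immersions\<close>

text \<open>On an open set \<open>S\<close> of a Euclidean space \<open>Ck_on k S f\<close> says that \<open>f\<close> is of class $C^k$.\<close>

primrec Ck_on :: "nat \<Rightarrow> 'a::euclidean_space set \<Rightarrow> ('a \<Rightarrow> 'b::real_normed_vector) \<Rightarrow> bool" where
  "Ck_on 0 S f \<longleftrightarrow> continuous_on S f"
| "Ck_on (Suc k) S f \<longleftrightarrow>
     (\<forall>x\<in>S. f differentiable (at x)) \<and> (\<forall>v. Ck_on k S (\<lambda>x. frechet_derivative f (at x) v))"

definition smooth_on :: "'a::euclidean_space set \<Rightarrow> ('a \<Rightarrow> 'b::real_normed_vector) \<Rightarrow> bool" where
  "smooth_on S f \<longleftrightarrow> (\<forall>k. Ck_on k S f)"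

text \<open>A chart is a pair (domain, coordinate map). The points of a manifold are all the elements
  of a type, and its smooth structure is given by an atlas.\<close>

type_synonym ('p, 'n) chart = "'p set \<times> ('p \<Rightarrow> real^'n)"

definition coord_dom :: "('p, 'm) chart \<Rightarrow> ('q, 'n) chart \<Rightarrow> ('p \<Rightarrow> 'q) \<Rightarrow> (real^'m) set" where
  "coord_dom c d f = snd c ` (fst c \<inter> f -` fst d)"

definition coord_rep :: "('p, 'm) chart \<Rightarrow> ('q, 'n) chart \<Rightarrow> ('p \<Rightarrow> 'q) \<Rightarrow> real^'m \<Rightarrow> real^'n" where
  "coord_rep c d f = snd d \<circ> f \<circ> inv_into (fst c) (snd c)"

definition smooth_atlas ::
  "('p::{t2_space,second_countable_topology}, 'n::finite) chart set \<Rightarrow> bool" where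
  "smooth_atlas A \<longleftrightarrow>
     (\<Union>c\<in>A. fst c) = UNIV \<and>
     (\<forall>c\<in>A. open (fst c) \<and> open (snd c ` fst c) \<and>
        homeomorphism (fst c) (snd c ` fst c) (snd c) (inv_into (fst c) (snd c))) \<and>
     (\<forall>c\<in>A. \<forall>d\<in>A. smooth_on (coord_dom c d id) (coord_rep c d id))"

definition immersion ::
  "('q::{t2_space,second_countable_topology}, 'm::finite) chart set \<Rightarrow>
   ('p::{t2_space,second_countable_topology}, 'n::finite) chart set \<Rightarrow> ('q \<Rightarrow> 'p) \<Rightarrow> bool" where
  "immersion A' A f \<longleftrightarrow>
     continuous_on UNIV f \<and>
     (\<forall>c\<in>A'. \<forall>d\<in>A. smooth_on (coord_dom c d f) (coord_rep c d f) \<and>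
        (\<forall>u\<in>coord_dom c d f. rank (jacobian (coord_rep c d f) (at u)) = CARD('m)))"

section \<open>Calculus in the coordinates of a tangent bundle\<close>

text \<open>In the bundle coordinates induced by a chart, a point of the tangent bundle is a pair \<open>(x, y)\<close>
  of type \<open>(real^'k) \<times> (real^'k)\<close>, and so is a tangent vector at that point: the pair \<open>(\<xi>, \<eta>)\<close>
  stands for $\xi^a\,\partial/\partial x^a + \eta^a\,\partial/\partial y^a$.
  Upper indices are listed before lower ones: \<open>N a b\<close> is $N^a{}_b$.\<close>

type_synonym 'k tcoord = "(real^'k) \<times> (real^'k)"
type_synonym 'k tvfield = "'k tcoord \<Rightarrow> 'k tcoord"

definition along :: "'k::finite tvfield \<Rightarrow> ('k tcoord \<Rightarrow> real) \<Rightarrow> 'k tcoord \<Rightarrow> real" where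
  "along X f p = frechet_derivative f (at p) (X p)"

definition d_base :: "'k::finite \<Rightarrow> 'k tvfield" where
  "d_base a p = (axis a 1, 0)"

definition d_fibre :: "'k::finite \<Rightarrow> 'k tvfield" where
  "d_fibre a p = (0, axis a 1)"

definition lie_bracket :: "'k::finite tvfield \<Rightarrow> 'k tvfield \<Rightarrow> 'k tvfield" where
  "lie_bracket X Y p = frechet_derivative Y (at p) (X p) - frechet_derivative X (at p) (Y p)"

section \<open>Finsler geometry in coordinates\<close>

definition fund_tensor :: "('k::finite tcoord \<Rightarrow> real) \<Rightarrow> 'k \<Rightarrow> 'k \<Rightarrow> 'k tcoord \<Rightarrow> real" where
  "fund_tensor F a b p = 1/2 * along (d_fibre a) (along (d_fibre b) (\<lambda>q. (F q)\<^sup>2)) p"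

definition cartan_tensor :: "('k::finite tcoord \<Rightarrow> real) \<Rightarrow> 'k \<Rightarrow> 'k \<Rightarrow> 'k \<Rightarrow> 'k tcoord \<Rightarrow> real" where
  "cartan_tensor F a b c p = 1/2 * along (d_fibre c) (fund_tensor F a b) p"

text \<open>A Finsler function on the tangent bundle is given by its representatives \<open>F c\<close> in the
  charts \<open>c\<close> of the atlas; the last clause says that they fit together to a function on the
  tangent bundle.\<close>

definition finsler_space ::
  "('p::{t2_space,second_countable_topology}, 'n::finite) chart set \<Rightarrow>
   (('p, 'n) chart \<Rightarrow> 'n tcoord \<Rightarrow> real) \<Rightarrow> bool" where
  "finsler_space A F \<longleftrightarrow>
     smooth_atlas A \<and>
     (\<forall>c\<in>A. smooth_on ((snd c ` fst c) \<times> (- {0})) (F c) \<and>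
        continuous_on ((snd c ` fst c) \<times> UNIV) (F c) \<and>
        (\<forall>x\<in>snd c ` fst c. \<forall>y.
           (\<forall>t>0. F c (x, t *\<^sub>R y) = t * F c (x, y)) \<and>
           (y \<noteq> 0 \<longrightarrow> F c (x, y) > 0 \<and>
             (\<forall>w. w \<noteq> 0 \<longrightarrow> (\<Sum>a\<in>UNIV. \<Sum>b\<in>UNIV. fund_tensor (F c) a b (x, y) * w $ a * w $ b) > 0)))) \<and>
     (\<forall>c\<in>A. \<forall>d\<in>A. \<forall>x\<in>coord_dom c d id. \<forall>y.
        F d (coord_rep c d id x, jacobian (coord_rep c d id) (at x) *v y) = F c (x, y))"

text \<open>The next three definitions are applied both to the ambient tensor $g_{ab}(x,y)$ and to the
  induced tensor $g_{\alpha\beta}(u,v)$.\<close>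

definition inv_tensor ::
  "('k::finite \<Rightarrow> 'k \<Rightarrow> 'k tcoord \<Rightarrow> real) \<Rightarrow> 'k \<Rightarrow> 'k \<Rightarrow> 'k tcoord \<Rightarrow> real" where
  "inv_tensor g a b p = matrix_inv (\<chi> i j. g i j p) $ a $ b"

definition christoffel ::
  "('k::finite \<Rightarrow> 'k \<Rightarrow> 'k tcoord \<Rightarrow> real) \<Rightarrow> 'k \<Rightarrow> 'k \<Rightarrow> 'k \<Rightarrow> 'k tcoord \<Rightarrow> real" where
  "christoffel g a b c p =
     1/2 * (\<Sum>d\<in>UNIV. inv_tensor g a d p *
       (along (d_base b) (g d c) p + along (d_base c) (g d b) p - along (d_base d) (g b c) p))"

definition spray ::
  "('k::finite \<Rightarrow> 'k \<Rightarrow> 'k tcoord \<Rightarrow> real) \<Rightarrow> 'k \<Rightarrow> 'k tcoord \<Rightarrow> real" where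
  "spray g a p = 1/2 * (\<Sum>b\<in>UNIV. \<Sum>c\<in>UNIV. christoffel g a b c p * snd p $ b * snd p $ c)"

definition cartan_nlc ::
  "('k::finite \<Rightarrow> 'k \<Rightarrow> 'k tcoord \<Rightarrow> real) \<Rightarrow> 'k \<Rightarrow> 'k \<Rightarrow> 'k tcoord \<Rightarrow> real" where
  "cartan_nlc g a b = along (d_fibre b) (spray g a)"

section \<open>Nonlinear connections and their adapted bases\<close>

definition adapted_h ::
  "('k::finite \<Rightarrow> 'k \<Rightarrow> 'k tcoord \<Rightarrow> real) \<Rightarrow> 'k \<Rightarrow> 'k tvfield" where
  "adapted_h N \<alpha> p = d_base \<alpha> p - (\<Sum>\<beta>\<in>UNIV. N \<beta> \<alpha> p *\<^sub>R d_fibre \<beta> p)"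

text \<open>The vertical part of the adapted basis does not depend on the nonlinear connection.\<close>

definition adapted_v ::
  "('k::finite \<Rightarrow> 'k \<Rightarrow> 'k tcoord \<Rightarrow> real) \<Rightarrow> 'k \<Rightarrow> 'k tvfield" where
  "adapted_v N \<alpha> = d_fibre \<alpha>"

text \<open>\<open>bracket_R N \<sigma> \<alpha> \<beta>\<close> is the coefficient $R^\sigma_{\alpha\beta}$ in
  $[\delta_\alpha,\delta_\beta] = R^\sigma_{\alpha\beta}\,\dot\partial_{1\sigma}$. With the opposite
  sign convention ($-R$ on the right-hand side) the deformation tensor \<open>D00\<close> below would have to be
  subtracted instead of added.\<close>

definition bracket_R ::
  "('k::finite \<Rightarrow> 'k \<Rightarrow> 'k tcoord \<Rightarrow> real) \<Rightarrow> 'k \<Rightarrow> 'k \<Rightarrow> 'k \<Rightarrow> 'k tcoord \<Rightarrow> real" where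
  "bracket_R N \<sigma> \<alpha> \<beta> p = along (adapted_h N \<beta>) (N \<sigma> \<alpha>) p - along (adapted_h N \<alpha>) (N \<sigma> \<beta>) p"

definition bracket_B ::
  "('k::finite \<Rightarrow> 'k \<Rightarrow> 'k tcoord \<Rightarrow> real) \<Rightarrow> 'k \<Rightarrow> 'k \<Rightarrow> 'k \<Rightarrow> 'k tcoord \<Rightarrow> real" where
  "bracket_B N \<sigma> \<alpha> \<beta> p = along (adapted_v N \<beta>) (N \<sigma> \<alpha>) p"

text \<open>The names are justified by the following brackets, valid wherever \<open>N\<close> is differentiable.\<close>

lemma adapted_h_derivative:
  fixes N :: "'k::finite \<Rightarrow> 'k \<Rightarrow> 'k tcoord \<Rightarrow> real"
  assumes "\<And>\<sigma> \<alpha>. N \<sigma> \<alpha> differentiable (at p)"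
  shows "frechet_derivative (adapted_h N \<alpha>) (at p) h =
    - (\<Sum>\<sigma>\<in>UNIV. frechet_derivative (N \<sigma> \<alpha>) (at p) h *\<^sub>R (0, axis \<sigma> 1))"
proof -
  have N: "(N \<sigma> \<alpha> has_derivative frechet_derivative (N \<sigma> \<alpha>) (at p)) (at p)" for \<sigma>
    using assms[of \<sigma> \<alpha>] by (simp only: frechet_derivative_works)
  have "((\<lambda>p. (axis \<alpha> 1, 0) - (\<Sum>\<sigma>\<in>UNIV. N \<sigma> \<alpha> p *\<^sub>R (0, axis \<sigma> 1))) has_derivative
      (\<lambda>h. 0 - (\<Sum>\<sigma>\<in>UNIV. frechet_derivative (N \<sigma> \<alpha>) (at p) h *\<^sub>R (0, axis \<sigma> 1)))) (at p)"
    by (rule has_derivative_diff[OF has_derivative_const has_derivative_sum])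
       (rule has_derivative_scaleR_left[OF N])
  then have "(adapted_h N \<alpha> has_derivative
      (\<lambda>h. - (\<Sum>\<sigma>\<in>UNIV. frechet_derivative (N \<sigma> \<alpha>) (at p) h *\<^sub>R (0, axis \<sigma> 1)))) (at p)"
    unfolding adapted_h_def[abs_def] d_base_def d_fibre_def diff_0 .
  from frechet_derivative_at[OF this, symmetric] show ?thesis by (rule fun_cong)
qed

lemma adapted_v_derivative: "frechet_derivative (adapted_v N \<alpha>) (at p) h = 0"
  unfolding adapted_v_def d_fibre_def[abs_def] frechet_derivative_const ..

lemma lie_bracket_adapted:
  fixes N :: "'k::finite \<Rightarrow> 'k \<Rightarrow> 'k tcoord \<Rightarrow> real"
  assumes "\<And>\<sigma> \<alpha>. N \<sigma> \<alpha> differentiable (at p)"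
  shows "lie_bracket (adapted_h N \<alpha>) (adapted_h N \<beta>) p =
      (\<Sum>\<sigma>\<in>UNIV. bracket_R N \<sigma> \<alpha> \<beta> p *\<^sub>R adapted_v N \<sigma> p)"
    and "lie_bracket (adapted_h N \<alpha>) (adapted_v N \<beta>) p =
      (\<Sum>\<sigma>\<in>UNIV. bracket_B N \<sigma> \<alpha> \<beta> p *\<^sub>R adapted_v N \<sigma> p)"
    and "lie_bracket (adapted_v N \<alpha>) (adapted_v N \<beta>) p = 0"
proof -
  have v: "adapted_v N \<sigma> p = (0, axis \<sigma> 1)" for \<sigma>
    by (simp add: adapted_v_def d_fibre_def)
  show "lie_bracket (adapted_h N \<alpha>) (adapted_h N \<beta>) p =
      (\<Sum>\<sigma>\<in>UNIV. bracket_R N \<sigma> \<alpha> \<beta> p *\<^sub>R adapted_v N \<sigma> p)"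
    unfolding lie_bracket_def adapted_h_derivative[OF assms] bracket_R_def along_def
      scaleR_left_diff_distrib sum_subtractf v by simp
  show "lie_bracket (adapted_h N \<alpha>) (adapted_v N \<beta>) p =
      (\<Sum>\<sigma>\<in>UNIV. bracket_B N \<sigma> \<alpha> \<beta> p *\<^sub>R adapted_v N \<sigma> p)"
    unfolding lie_bracket_def adapted_h_derivative[OF assms] adapted_v_derivative bracket_B_def
      along_def v diff_0 minus_minus ..
  show "lie_bracket (adapted_v N \<alpha>) (adapted_v N \<beta>) p = 0"
    unfolding lie_bracket_def adapted_v_derivative by (rule diff_self)
qed

section \<open>Submanifolds\<close>

text \<open>Here \<open>x\<close> is the coordinate expression \<open>u \<mapsto> x u\<close> of the immersion, and \<open>F\<close> is the fundamental
  function of the ambient space in the coordinates used for \<open>x\<close>.\<close>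

definition lift :: "(real^'m::finite \<Rightarrow> real^'n::finite) \<Rightarrow> 'm tcoord \<Rightarrow> 'n tcoord" where
  "lift x p = (x (fst p), jacobian x (at (fst p)) *v snd p)"

definition B1 :: "(real^'m::finite \<Rightarrow> real^'n::finite) \<Rightarrow> 'n \<Rightarrow> 'm \<Rightarrow> 'm tcoord \<Rightarrow> real" where
  "B1 x a \<alpha> p = jacobian x (at (fst p)) $ a $ \<alpha>"

definition B2 :: "(real^'m::finite \<Rightarrow> real^'n::finite) \<Rightarrow> 'n \<Rightarrow> 'm \<Rightarrow> 'm \<Rightarrow> 'm tcoord \<Rightarrow> real" where
  "B2 x a \<alpha> \<beta> = along (d_base \<alpha>) (B1 x a \<beta>)"

definition B0 :: "(real^'m::finite \<Rightarrow> real^'n::finite) \<Rightarrow> 'n \<Rightarrow> 'm \<Rightarrow> 'm tcoord \<Rightarrow> real" where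
  "B0 x a \<beta> p = (\<Sum>\<alpha>\<in>UNIV. B2 x a \<alpha> \<beta> p * snd p $ \<alpha>)"

definition induced_tensor ::
  "('n::finite tcoord \<Rightarrow> real) \<Rightarrow> (real^'m::finite \<Rightarrow> real^'n) \<Rightarrow> 'm \<Rightarrow> 'm \<Rightarrow> 'm tcoord \<Rightarrow> real" where
  "induced_tensor F x \<alpha> \<beta> p =
     (\<Sum>a\<in>UNIV. \<Sum>b\<in>UNIV. fund_tensor F a b (lift x p) * B1 x a \<alpha> p * B1 x b \<beta> p)"

text \<open>A moving frame on an open set \<open>W\<close> of the slit tangent bundle of the submanifold:
  \<open>E a \<rho>\<close> is $B^a_{\bar\rho}$, and \<open>T \<alpha> a\<close>, \<open>V \<rho> a\<close> are the dual $B^\alpha_a$, $B^{\bar\rho}_a$.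
  The vectors $B_{\bar\rho}$ are normal to the submanifold; otherwise $B^\alpha_a$, and with it the
  induced nonlinear connection, would depend on the choice of the frame.\<close>

definition moving_frame ::
  "('n::finite tcoord \<Rightarrow> real) \<Rightarrow> (real^'m::finite \<Rightarrow> real^'n) \<Rightarrow> 'm tcoord set \<Rightarrow>
   ('n \<Rightarrow> 'r::finite \<Rightarrow> 'm tcoord \<Rightarrow> real) \<Rightarrow> ('m \<Rightarrow> 'n \<Rightarrow> 'm tcoord \<Rightarrow> real) \<Rightarrow>
   ('r \<Rightarrow> 'n \<Rightarrow> 'm tcoord \<Rightarrow> real) \<Rightarrow> bool" where
  "moving_frame F x W E T V \<longleftrightarrow>
     (\<forall>a \<rho>. smooth_on W (E a \<rho>)) \<and>
     (\<forall>p\<in>W.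
       (\<forall>\<alpha> \<rho>. (\<Sum>a\<in>UNIV. \<Sum>b\<in>UNIV. fund_tensor F a b (lift x p) * B1 x a \<alpha> p * E b \<rho> p) = 0) \<and>
       (\<forall>\<alpha> \<beta>. (\<Sum>a\<in>UNIV. B1 x a \<beta> p * T \<alpha> a p) = (if \<alpha> = \<beta> then 1 else 0)) \<and>
       (\<forall>\<beta> \<rho>. (\<Sum>a\<in>UNIV. B1 x a \<beta> p * V \<rho> a p) = 0) \<and>
       (\<forall>\<alpha> \<rho>. (\<Sum>a\<in>UNIV. T \<alpha> a p * E a \<rho> p) = 0) \<and>
       (\<forall>\<rho> \<tau>. (\<Sum>a\<in>UNIV. V \<rho> a p * E a \<tau> p) = (if \<rho> = \<tau> then 1 else 0)) \<and>
       (\<forall>a b. (\<Sum>\<alpha>\<in>UNIV. B1 x a \<alpha> p * T \<alpha> b p) + (\<Sum>\<rho>\<in>UNIV. E a \<rho> p * V \<rho> b p)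
          = (if a = b then 1 else 0)))"

text \<open>The common factor $B^a_{0\beta} + N^a{}_b B^b_\beta$ of $\check N$ and $K$.\<close>

definition BN ::
  "('n::finite tcoord \<Rightarrow> real) \<Rightarrow> (real^'m::finite \<Rightarrow> real^'n) \<Rightarrow> 'n \<Rightarrow> 'm \<Rightarrow> 'm tcoord \<Rightarrow> real" where
  "BN F x a \<beta> p =
     B0 x a \<beta> p + (\<Sum>b\<in>UNIV. cartan_nlc (fund_tensor F) a b (lift x p) * B1 x b \<beta> p)"

definition induced_nlc ::
  "('n::finite tcoord \<Rightarrow> real) \<Rightarrow> (real^'m::finite \<Rightarrow> real^'n) \<Rightarrow>
   ('m \<Rightarrow> 'n \<Rightarrow> 'm tcoord \<Rightarrow> real) \<Rightarrow> 'm \<Rightarrow> 'm \<Rightarrow> 'm tcoord \<Rightarrow> real" where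
  "induced_nlc F x T \<alpha> \<beta> p = (\<Sum>a\<in>UNIV. T \<alpha> a p * BN F x a \<beta> p)"

definition intrinsic_nlc ::
  "('n::finite tcoord \<Rightarrow> real) \<Rightarrow> (real^'m::finite \<Rightarrow> real^'n) \<Rightarrow> 'm \<Rightarrow> 'm \<Rightarrow> 'm tcoord \<Rightarrow> real" where
  "intrinsic_nlc F x = cartan_nlc (induced_tensor F x)"

definition normal_K ::
  "('n::finite tcoord \<Rightarrow> real) \<Rightarrow> (real^'m::finite \<Rightarrow> real^'n) \<Rightarrow>
   ('r::finite \<Rightarrow> 'n \<Rightarrow> 'm tcoord \<Rightarrow> real) \<Rightarrow> 'r \<Rightarrow> 'm \<Rightarrow> 'm tcoord \<Rightarrow> real" where
  "normal_K F x V \<rho> \<beta> p = (\<Sum>a\<in>UNIV. V \<rho> a p * BN F x a \<beta> p)"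

definition mixed_g ::
  "('n::finite tcoord \<Rightarrow> real) \<Rightarrow> (real^'m::finite \<Rightarrow> real^'n) \<Rightarrow>
   ('n \<Rightarrow> 'r::finite \<Rightarrow> 'm tcoord \<Rightarrow> real) \<Rightarrow> 'r \<Rightarrow> 'm \<Rightarrow> 'm \<Rightarrow> 'm tcoord \<Rightarrow> real" where
  "mixed_g F x E \<rho> \<alpha> \<beta> p =
     (\<Sum>\<gamma>\<in>UNIV. \<Sum>a\<in>UNIV. \<Sum>b\<in>UNIV. \<Sum>c\<in>UNIV.
        inv_tensor (induced_tensor F x) \<alpha> \<gamma> p * cartan_tensor F a b c (lift x p) *
        E a \<rho> p * B1 x b \<gamma> p * B1 x c \<beta> p)"

definition deform_D ::
  "('n::finite tcoord \<Rightarrow> real) \<Rightarrow> (real^'m::finite \<Rightarrow> real^'n) \<Rightarrow>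
   ('n \<Rightarrow> 'r::finite \<Rightarrow> 'm tcoord \<Rightarrow> real) \<Rightarrow> ('r \<Rightarrow> 'n \<Rightarrow> 'm tcoord \<Rightarrow> real) \<Rightarrow>
   'm \<Rightarrow> 'm \<Rightarrow> 'm tcoord \<Rightarrow> real" where
  "deform_D F x E V \<alpha> \<beta> p =
     (\<Sum>\<rho>\<in>UNIV. \<Sum>\<gamma>\<in>UNIV. mixed_g F x E \<rho> \<alpha> \<beta> p * normal_K F x V \<rho> \<gamma> p * snd p $ \<gamma>)"

definition D00 ::
  "('m::finite \<Rightarrow> 'm \<Rightarrow> 'm tcoord \<Rightarrow> real) \<Rightarrow> ('m \<Rightarrow> 'm \<Rightarrow> 'm tcoord \<Rightarrow> real) \<Rightarrow>
   'm \<Rightarrow> 'm \<Rightarrow> 'm \<Rightarrow> 'm tcoord \<Rightarrow> real" where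
  "D00 N D \<alpha> \<beta> \<gamma> p =
     along (adapted_h N \<gamma>) (D \<alpha> \<beta>) p - along (adapted_h N \<beta>) (D \<alpha> \<gamma>) p
     + (\<Sum>\<delta>\<in>UNIV. D \<delta> \<beta> p * along (adapted_v N \<delta>) (\<lambda>q. N \<alpha> \<gamma> q + D \<alpha> \<gamma> q) p)
     - (\<Sum>\<delta>\<in>UNIV. D \<delta> \<gamma> p * along (adapted_v N \<delta>) (\<lambda>q. N \<alpha> \<beta> q + D \<alpha> \<beta> q) p)"

definition D01 ::
  "('m::finite \<Rightarrow> 'm \<Rightarrow> 'm tcoord \<Rightarrow> real) \<Rightarrow> ('m \<Rightarrow> 'm \<Rightarrow> 'm tcoord \<Rightarrow> real) \<Rightarrow>
   'm \<Rightarrow> 'm \<Rightarrow> 'm \<Rightarrow> 'm tcoord \<Rightarrow> real" where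
  "D01 N D \<alpha> \<beta> \<gamma> p = along (adapted_v N \<gamma>) (D \<alpha> \<beta>) p"

end

theory Submission
  imports Defs
begin

text \<open>With $L = F^2$, homogeneity turns the spray into
  $g_{ab}G^b = \frac14(y^c\partial_c\dot\partial_a L - \partial_a L)$. The same formula holds for the
  induced function $L(x(u), B v)$, which is again a Finsler function, and the chain rule gives
  $g_{\alpha\gamma}\check G^\gamma = B^a_\alpha g_{ac}\Phi^c$ with
  $\Phi^c = G^c + \frac12 B^c_{\alpha\beta}v^\alpha v^\beta$. Differentiating this identity in
  $v^\beta$ produces $\mathring N$ on the left and $\check N$ on the right, because
  $\dot\partial_\beta\Phi^c = B^c_{0\beta} + N^c{}_bB^b_\beta$; the derivatives of the metric
  contribute $2g_{acd}B^a_\alpha B^d_\beta$ contracted with the normal part of $\Phi$, which is half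
  of $B_{\bar\alpha}K^{\bar\alpha}_\gamma v^\gamma$ since $G$ is homogeneous of degree two. This is $D$.
  The frame determines $B^\alpha_a = g^{\alpha\gamma}B^b_\gamma g_{ba}$, so both connections are
  smooth and the relations between the brackets follow by differentiating $\mathring N = \check N + D$.\<close>

section \<open>Calculus of smooth functions\<close>

text \<open>Indices stay lowered as long as possible. Lowered, the spray is an expression in L
  alone, which restricts to the submanifold by composition with \<open>lift x\<close>, and its fibre
  derivative involves no derivative of an inverse matrix; indices are raised again by solving a
  linear system. F is assumed smooth only off the null section, so everything takes place over slit
  bundles, and each identity that is differentiated later is established on an open set. The dual
  frame is given only by pointwise duality relations. Differentiability of the induced connection
  therefore has to be derived, whereas the derivatives of D are read off from the difference of the
  two connections.\<close>

lemma Ck_on_cong: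
  assumes "open S" "\<And>x. x \<in> S \<Longrightarrow> f x = g x" "Ck_on k S f"
  shows "Ck_on k S g"
  using assms(2,3)
proof (induction k arbitrary: f g)
  case 0
  then show ?case by (simp cong: continuous_on_cong)
next
  case (Suc k)
  have d: "g differentiable at x \<and> frechet_derivative f (at x) = frechet_derivative g (at x)"
    if "x \<in> S" for x
  proof -
    have f: "f differentiable at x" using Suc.prems(2) that by simp
    then have "(g has_derivative frechet_derivative f (at x)) (at x)"
      using Suc.prems(1) that assms(1)
      by (auto simp: frechet_derivative_works intro: has_derivative_transform_within_open)
    with frechet_derivative_at[OF this] show ?thesis by (auto simp: differentiable_def)
  qed
  have "Ck_on k S (\<lambda>x. frechet_derivative g (at x) v)" for v
    by (rule Suc.IH[of "\<lambda>x. frechet_derivative f (at x) v"]) (use d Suc.prems(2) in simp_all)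
  with d show ?case by simp
qed

lemma Ck_on_subset: "Ck_on k S f \<Longrightarrow> R \<subseteq> S \<Longrightarrow> Ck_on k R f"
  by (induction k arbitrary: f) (auto intro: continuous_on_subset)

lemma Ck_on_SucD: "Ck_on (Suc k) S f \<Longrightarrow> Ck_on k S f"
proof (induction k arbitrary: f)
  case 0
  then show ?case
    by (simp add: continuous_at_imp_continuous_on differentiable_imp_continuous_within)
next
  case (Suc k)
  from Suc.prems have "f differentiable at x" if "x \<in> S" for x
    using that by simp
  moreover have "Ck_on (Suc k) S (\<lambda>x. frechet_derivative f (at x) v)" for v
    using Suc.prems by (simp only: Ck_on.simps(2)[of "Suc k"])
  ultimately show ?case using Suc.IH by simp
qed

lemma Ck_on_const: "Ck_on k S (\<lambda>x. c)"
  by (induction k arbitrary: c) simp_all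

text \<open>The pattern of all closure proofs below: on an open set derivatives are local, so
  \<open>Ck_on_cong\<close> may replace the derivative by its formula, to which the induction
  hypothesis applies. The functions are kept arbitrary in the induction because it passes to their
  derivatives.\<close>

lemma Ck_on_add:
  assumes "open S"
  shows "Ck_on k S f \<Longrightarrow> Ck_on k S g \<Longrightarrow> Ck_on k S (\<lambda>x. f x + g x)"
proof (induction k arbitrary: f g)
  case 0
  then show ?case by (simp add: continuous_on_add)
next
  case (Suc k)
  have d: "frechet_derivative (\<lambda>x. f x + g x) (at x) v =
      frechet_derivative f (at x) v + frechet_derivative g (at x) v" if "x \<in> S" for x v
  proof -
    have "((\<lambda>x. f x + g x) has_derivative
        (\<lambda>v. frechet_derivative f (at x) v + frechet_derivative g (at x) v)) (at x)"
      using Suc.prems that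
      by (intro has_derivative_add) (simp_all add: frechet_derivative_works[symmetric])
    from frechet_derivative_at[OF this] show ?thesis by metis
  qed
  have "Ck_on k S (\<lambda>x. frechet_derivative (\<lambda>x. f x + g x) (at x) v)" for v
    by (rule Ck_on_cong[OF assms d[symmetric] Suc.IH]) (use Suc.prems in auto)
  then show ?case using Suc.prems by (auto intro: differentiable_add)
qed

lemma Ck_on_scaleR:
  assumes "open S"
  shows "Ck_on k S f \<Longrightarrow> Ck_on k S g \<Longrightarrow> Ck_on k S (\<lambda>x. f x *\<^sub>R g x)"
proof (induction k arbitrary: f g)
  case 0
  then show ?case by (simp add: continuous_on_scaleR)
next
  case (Suc k)
  have h: "((\<lambda>x. f x *\<^sub>R g x) has_derivative
      (\<lambda>v. f x *\<^sub>R frechet_derivative g (at x) v + frechet_derivative f (at x) v *\<^sub>R g x)) (at x)"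
    if "x \<in> S" for x
    using Suc.prems that
    by (intro has_derivative_scaleR) (simp_all add: frechet_derivative_works[symmetric])
  have d: "frechet_derivative (\<lambda>x. f x *\<^sub>R g x) (at x) v =
      f x *\<^sub>R frechet_derivative g (at x) v + frechet_derivative f (at x) v *\<^sub>R g x"
    if "x \<in> S" for x v
    using frechet_derivative_at[OF h[OF that]] by metis
  \<comment> \<open>The Leibniz formula also contains the undifferentiated factors, which enter the
    induction at the lower order.\<close>
  have k: "Ck_on k S f" "Ck_on k S g"
    by (rule Ck_on_SucD, rule Suc.prems)+
  have "Ck_on k S (\<lambda>x. frechet_derivative (\<lambda>x. f x *\<^sub>R g x) (at x) v)" for v
    by (intro Ck_on_cong[OF assms d[symmetric]] Ck_on_add[OF assms] Suc.IH k)
      (use Suc.prems in auto)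
  then show ?case using h by (auto simp: differentiable_def)
qed

lemma Ck_on_sum:
  assumes "open S" "\<And>i. i \<in> I \<Longrightarrow> Ck_on k S (f i)"
  shows "Ck_on k S (\<lambda>x. \<Sum>i\<in>I. f i x)"
  using assms(2)
  by (induction I rule: infinite_finite_induct)
    (auto intro: Ck_on_const Ck_on_add[OF assms(1)])

lemma Ck_on_bounded_linear_compose:
  assumes "open S" "bounded_linear h"
  shows "Ck_on k S f \<Longrightarrow> Ck_on k S (\<lambda>x. h (f x))"
proof (induction k arbitrary: f)
  case 0
  then show ?case by (simp add: bounded_linear.continuous_on[OF assms(2)])
next
  case (Suc k)
  have h: "((\<lambda>x. h (f x)) has_derivative (\<lambda>v. h (frechet_derivative f (at x) v))) (at x)"
    if "x \<in> S" for x
    using Suc.prems that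
    by (intro bounded_linear.has_derivative[OF assms(2)])
      (simp_all add: frechet_derivative_works[symmetric])
  have d: "frechet_derivative (\<lambda>x. h (f x)) (at x) v = h (frechet_derivative f (at x) v)"
    if "x \<in> S" for x v
    using frechet_derivative_at[OF h[OF that]] by metis
  have "Ck_on k S (\<lambda>x. frechet_derivative (\<lambda>x. h (f x)) (at x) v)" for v
    by (rule Ck_on_cong[OF assms(1) d[symmetric] Suc.IH]) (use Suc.prems in auto)
  then show ?case using h by (auto simp: differentiable_def)
qed

lemma Ck_on_bounded_linear: "bounded_linear h \<Longrightarrow> Ck_on k S h"
  by (cases k)
    (simp_all add: linear_continuous_on bounded_linear_imp_differentiable
      frechet_derivative_at[OF bounded_linear_imp_has_derivative, symmetric] Ck_on_const)

lemma Ck_on_compose: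
  fixes g :: "'a::euclidean_space \<Rightarrow> 'b::euclidean_space"
  assumes "open S" "g ` S \<subseteq> R"
  shows "Ck_on k R f \<Longrightarrow> Ck_on k S g \<Longrightarrow> Ck_on k S (\<lambda>x. f (g x))"
proof (induction k arbitrary: f)
  case 0
  then show ?case using assms(2) by (auto intro: continuous_on_compose2)
next
  case (Suc k)
  have h: "((\<lambda>x. f (g x)) has_derivative
      (\<lambda>v. frechet_derivative f (at (g x)) (frechet_derivative g (at x) v))) (at x)"
    if "x \<in> S" for x
    using Suc.prems that assms(2)
    by (intro has_derivative_compose[of g _ x UNIV f])
      (auto simp add: frechet_derivative_works[symmetric])
  \<comment> \<open>In the chain rule the direction in which f is differentiated varies with x,
    while \<open>Ck_on\<close> speaks of fixed directions. Expanding this direction in the basis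
    gives a finite sum of products of functions covered by the induction hypothesis.\<close>
  have d: "frechet_derivative (\<lambda>x. f (g x)) (at x) v =
      (\<Sum>b\<in>Basis. (frechet_derivative g (at x) v \<bullet> b) *\<^sub>R frechet_derivative f (at (g x)) b)"
    if "x \<in> S" for x v
  proof -
    have lin: "linear (frechet_derivative f (at (g x)))"
      using Suc.prems(1) assms(2) that by (auto intro: linear_frechet_derivative)
    have "frechet_derivative (\<lambda>x. f (g x)) (at x) v =
        frechet_derivative f (at (g x)) (frechet_derivative g (at x) v)"
      using frechet_derivative_at[OF h[OF that]] by metis
    also have "\<dots> = frechet_derivative f (at (g x))
        (\<Sum>b\<in>Basis. (frechet_derivative g (at x) v \<bullet> b) *\<^sub>R b)"
      by (simp add: euclidean_representation)
    also have "\<dots> = (\<Sum>b\<in>Basis.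
        (frechet_derivative g (at x) v \<bullet> b) *\<^sub>R frechet_derivative f (at (g x)) b)"
      by (simp only: linear_sum[OF lin] linear_cmul[OF lin])
    finally show ?thesis .
  qed
  have g: "Ck_on k S g" by (rule Ck_on_SucD[OF Suc.prems(2)])
  have "Ck_on k S (\<lambda>x. frechet_derivative (\<lambda>x. f (g x)) (at x) v)" for v
    using Suc.prems
    by (intro Ck_on_cong[OF assms(1) d[symmetric]] Ck_on_sum[OF assms(1)] Ck_on_scaleR[OF assms(1)]
        Suc.IH[OF _ g] Ck_on_bounded_linear_compose[OF assms(1) bounded_linear_inner_left]) auto
  then show ?case using h by (auto simp: differentiable_def)
qed

text \<open>The derivative of 1/f is a product of f' with two factors 1/f, so regularity of order k
  for 1/f yields order k + 1.\<close>

lemma Ck_on_inverse: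
  fixes f :: "'a::euclidean_space \<Rightarrow> real"
  assumes "open S" "\<And>x. x \<in> S \<Longrightarrow> f x \<noteq> 0"
  shows "Ck_on k S f \<Longrightarrow> Ck_on k S (\<lambda>x. inverse (f x))"
proof (induction k)
  case 0
  then show ?case using assms(2) by (auto intro: continuous_on_inverse)
next
  case (Suc k)
  have h: "((\<lambda>x. inverse (f x)) has_derivative
      (\<lambda>v. - (inverse (f x) * frechet_derivative f (at x) v * inverse (f x)))) (at x)"
    if "x \<in> S" for x
    using Suc.prems that assms(2)
    by (intro Deriv.has_derivative_inverse) (auto simp add: frechet_derivative_works[symmetric])
  have d: "frechet_derivative (\<lambda>x. inverse (f x)) (at x) v =
      (- 1) *\<^sub>R (inverse (f x) *\<^sub>R (inverse (f x) *\<^sub>R frechet_derivative f (at x) v))"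
    if "x \<in> S" for x v
    using fun_cong[OF frechet_derivative_at[OF h[OF that]], of v] by (simp add: mult_ac)
  have k: "Ck_on k S (\<lambda>x. inverse (f x))" by (rule Suc.IH[OF Ck_on_SucD[OF Suc.prems]])
  have "Ck_on k S (\<lambda>x. frechet_derivative (\<lambda>x. inverse (f x)) (at x) v)" for v
    using Suc.prems
    by (intro Ck_on_cong[OF assms(1) d[symmetric]] Ck_on_scaleR[OF assms(1)] k Ck_on_const) auto
  then show ?case using h by (auto simp: differentiable_def)
qed

section \<open>Closure properties of smooth maps\<close>

lemma smooth_on_cong: "open S \<Longrightarrow> smooth_on S f \<Longrightarrow> (\<And>x. x \<in> S \<Longrightarrow> f x = g x) \<Longrightarrow> smooth_on S g"
  unfolding smooth_on_def using Ck_on_cong by blast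

lemma smooth_on_subset: "smooth_on S f \<Longrightarrow> R \<subseteq> S \<Longrightarrow> smooth_on R f"
  unfolding smooth_on_def using Ck_on_subset by blast

lemma smooth_on_const: "smooth_on S (\<lambda>x. c)"
  by (simp add: smooth_on_def Ck_on_const)

lemma smooth_on_bounded_linear: "bounded_linear h \<Longrightarrow> smooth_on S h"
  by (simp add: smooth_on_def Ck_on_bounded_linear)

lemma smooth_on_bounded_linear_compose:
  "open S \<Longrightarrow> bounded_linear h \<Longrightarrow> smooth_on S f \<Longrightarrow> smooth_on S (\<lambda>x. h (f x))"
  by (simp add: smooth_on_def Ck_on_bounded_linear_compose)

lemma smooth_on_add:
  "open S \<Longrightarrow> smooth_on S f \<Longrightarrow> smooth_on S g \<Longrightarrow> smooth_on S (\<lambda>x. f x + g x)"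
  by (simp add: smooth_on_def Ck_on_add)

lemma smooth_on_scaleR:
  "open S \<Longrightarrow> smooth_on S f \<Longrightarrow> smooth_on S g \<Longrightarrow> smooth_on S (\<lambda>x. f x *\<^sub>R g x)"
  by (simp add: smooth_on_def Ck_on_scaleR)

lemma smooth_on_mult:
  fixes f g :: "'a::euclidean_space \<Rightarrow> real"
  shows "open S \<Longrightarrow> smooth_on S f \<Longrightarrow> smooth_on S g \<Longrightarrow> smooth_on S (\<lambda>x. f x * g x)"
  using smooth_on_scaleR[of S f g] by simp

lemma smooth_on_diff:
  fixes f g :: "'a::euclidean_space \<Rightarrow> real"
  assumes "open S" "smooth_on S f" "smooth_on S g"
  shows "smooth_on S (\<lambda>x. f x - g x)"
  using smooth_on_add[OF assms(1,2) smooth_on_mult[OF assms(1) smooth_on_const[of S "-1"] assms(3)]]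
  by simp

lemma smooth_on_sum:
  "open S \<Longrightarrow> (\<And>i. i \<in> I \<Longrightarrow> smooth_on S (f i)) \<Longrightarrow> smooth_on S (\<lambda>x. \<Sum>i\<in>I. f i x)"
  by (simp add: smooth_on_def Ck_on_sum)

lemma smooth_on_prod:
  fixes f :: "'i \<Rightarrow> 'a::euclidean_space \<Rightarrow> real"
  assumes "open S" "\<And>i. i \<in> I \<Longrightarrow> smooth_on S (f i)"
  shows "smooth_on S (\<lambda>x. \<Prod>i\<in>I. f i x)"
  using assms(2)
  by (induction I rule: infinite_finite_induct)
    (auto intro: smooth_on_const smooth_on_mult[OF assms(1)])

lemma smooth_on_inverse:
  fixes f :: "'a::euclidean_space \<Rightarrow> real"
  shows "open S \<Longrightarrow> smooth_on S f \<Longrightarrow> (\<And>x. x \<in> S \<Longrightarrow> f x \<noteq> 0) \<Longrightarrow> smooth_on S (\<lambda>x. inverse (f x))"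
  by (simp add: smooth_on_def Ck_on_inverse)

lemma smooth_on_compose:
  fixes g :: "'a::euclidean_space \<Rightarrow> 'b::euclidean_space"
  shows "open S \<Longrightarrow> smooth_on R f \<Longrightarrow> smooth_on S g \<Longrightarrow> g ` S \<subseteq> R \<Longrightarrow> smooth_on S (\<lambda>x. f (g x))"
  unfolding smooth_on_def using Ck_on_compose by blast

lemma smooth_on_frechet_derivative:
  "smooth_on S f \<Longrightarrow> smooth_on S (\<lambda>x. frechet_derivative f (at x) v)"
  unfolding smooth_on_def using Ck_on.simps(2) by blast

lemma smooth_on_imp_differentiable: "smooth_on S f \<Longrightarrow> x \<in> S \<Longrightarrow> f differentiable at x"
  unfolding smooth_on_def using Ck_on.simps(2)[of 0] by blast

lemma smooth_on_imp_has_derivative: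
  "smooth_on S f \<Longrightarrow> x \<in> S \<Longrightarrow> (f has_derivative frechet_derivative f (at x)) (at x)"
  using smooth_on_imp_differentiable frechet_derivative_works by blast

lemma smooth_on_imp_continuous_on: "smooth_on S f \<Longrightarrow> continuous_on S f"
  unfolding smooth_on_def using Ck_on.simps(1) by blast

text \<open>The mean value theorem is applied twice: along \<open>v\<close> to the increment in
  \<open>w\<close>, then along \<open>w\<close> to the derivative in direction \<open>v\<close>. The
  left side of the resulting equation is symmetric in \<open>v\<close> and \<open>w\<close>, the
  right side is not; this asymmetry is what proves that derivatives commute.\<close>

lemma second_difference_eq:
  fixes f :: "'a::euclidean_space \<Rightarrow> real"
  assumes f: "smooth_on S f" and h: "0 < h"
    and sub: "\<And>s t. 0 \<le> s \<Longrightarrow> s \<le> h \<Longrightarrow> 0 \<le> t \<Longrightarrow> t \<le> h \<Longrightarrow> p + s *\<^sub>R v + t *\<^sub>R w \<in> S"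
  shows "\<exists>s t. 0 < s \<and> s < h \<and> 0 < t \<and> t < h \<and>
    f (p + h *\<^sub>R v + h *\<^sub>R w) - f (p + h *\<^sub>R v) - f (p + h *\<^sub>R w) + f p =
    h * h * frechet_derivative (\<lambda>q. frechet_derivative f (at q) v) (at (p + s *\<^sub>R v + t *\<^sub>R w)) w"
proof -
  let ?D = "\<lambda>q. frechet_derivative f (at q) v"
  \<comment> \<open>The vanishing summand \<open>0 *\<^sub>R w\<close> is kept so that the fact
    \<open>line\<close> serves both terms, with t = h and t = 0.\<close>
  let ?g = "\<lambda>s. f (p + s *\<^sub>R v + h *\<^sub>R w) - f (p + s *\<^sub>R v + 0 *\<^sub>R w)"
  have line: "((\<lambda>s. f (p + s *\<^sub>R v + t *\<^sub>R w)) has_derivative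
      (\<lambda>r. frechet_derivative f (at (p + s *\<^sub>R v + t *\<^sub>R w)) (r *\<^sub>R v))) (at s)"
    if "0 \<le> s" "s \<le> h" "0 \<le> t" "t \<le> h" for s t
    by (rule has_derivative_compose[of "\<lambda>s. p + s *\<^sub>R v + t *\<^sub>R w" _ s UNIV f])
      (auto intro!: derivative_eq_intros smooth_on_imp_has_derivative[OF f sub] that)
  have scale: "frechet_derivative f (at q) (r *\<^sub>R v) = r * ?D q" if "q \<in> S" for q r
    using linear_cmul[OF linear_frechet_derivative[OF smooth_on_imp_differentiable[OF f that]]]
    by simp
  have g: "(?g has_derivative (\<lambda>r. r * (?D (p + s *\<^sub>R v + h *\<^sub>R w) - ?D (p + s *\<^sub>R v + 0 *\<^sub>R w)))) (at s)"
    if "0 \<le> s" "s \<le> h" for s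
    using has_derivative_diff[OF line[OF that, of h] line[OF that, of 0]] h that
    by (simp only: scale sub less_imp_le order_refl right_diff_distrib)
  obtain s where s: "0 < s" "s < h"
    "?g h - ?g 0 = (h - 0) * (?D (p + s *\<^sub>R v + h *\<^sub>R w) - ?D (p + s *\<^sub>R v + 0 *\<^sub>R w))"
  proof (rule mvt[OF h, of ?g "\<lambda>s r. r * (?D (p + s *\<^sub>R v + h *\<^sub>R w) - ?D (p + s *\<^sub>R v + 0 *\<^sub>R w))"])
    show "continuous_on {0..h} ?g"
      using g by (auto intro!: continuous_at_imp_continuous_on has_derivative_continuous)
    show "(?g has_derivative (\<lambda>r. r * (?D (p + s *\<^sub>R v + h *\<^sub>R w) - ?D (p + s *\<^sub>R v + 0 *\<^sub>R w)))) (at s)"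
      if "0 < s" "s < h" for s using g that by simp
  qed
  have D: "smooth_on S ?D" by (rule smooth_on_frechet_derivative[OF f])
  have k: "((\<lambda>t. ?D (p + s *\<^sub>R v + t *\<^sub>R w)) has_derivative
      (\<lambda>r. frechet_derivative ?D (at (p + s *\<^sub>R v + t *\<^sub>R w)) (r *\<^sub>R w))) (at t)"
    if "0 \<le> t" "t \<le> h" for t
    by (rule has_derivative_compose[of "\<lambda>t. p + s *\<^sub>R v + t *\<^sub>R w" _ t UNIV ?D])
      (use s that in \<open>auto intro!: derivative_eq_intros smooth_on_imp_has_derivative[OF D sub]\<close>)
  obtain t where t: "0 < t" "t < h" "?D (p + s *\<^sub>R v + h *\<^sub>R w) - ?D (p + s *\<^sub>R v + 0 *\<^sub>R w) =
      frechet_derivative ?D (at (p + s *\<^sub>R v + t *\<^sub>R w)) ((h - 0) *\<^sub>R w)"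
  proof (rule mvt[OF h, of "\<lambda>t. ?D (p + s *\<^sub>R v + t *\<^sub>R w)"])
    show "continuous_on {0..h} (\<lambda>t. ?D (p + s *\<^sub>R v + t *\<^sub>R w))"
      using k by (auto intro!: continuous_at_imp_continuous_on has_derivative_continuous)
    show "((\<lambda>t. ?D (p + s *\<^sub>R v + t *\<^sub>R w)) has_derivative
        (\<lambda>r. frechet_derivative ?D (at (p + s *\<^sub>R v + t *\<^sub>R w)) (r *\<^sub>R w))) (at t)"
      if "0 < t" "t < h" for t using k that by simp
  qed
  have "p + s *\<^sub>R v + t *\<^sub>R w \<in> S" using s t sub by simp
  then have "frechet_derivative ?D (at (p + s *\<^sub>R v + t *\<^sub>R w)) (h *\<^sub>R w) =
      h * frechet_derivative ?D (at (p + s *\<^sub>R v + t *\<^sub>R w)) w"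
    using linear_cmul[OF linear_frechet_derivative[OF smooth_on_imp_differentiable[OF D]]]
    by simp
  then show ?thesis using s t by (intro exI[of _ s] exI[of _ t]) simp
qed

text \<open>Both mixed derivatives, taken at suitable points of a small parallelogram at
  \<open>p\<close>, equal the same second difference divided by its squared side parameter;
  continuity carries the equality to \<open>p\<close>.\<close>

lemma frechet_derivative_commute:
  fixes f :: "'a::euclidean_space \<Rightarrow> real"
  assumes S: "open S" and f: "smooth_on S f" and p: "p \<in> S"
  shows "frechet_derivative (\<lambda>q. frechet_derivative f (at q) v) (at p) w =
    frechet_derivative (\<lambda>q. frechet_derivative f (at q) w) (at p) v"
proof -
  let ?D = "\<lambda>v w q. frechet_derivative (\<lambda>q. frechet_derivative f (at q) v) (at q) w"
  have close: "\<exists>d>0. \<forall>q. dist q p < d \<longrightarrow> \<bar>?D v w q - ?D v w p\<bar> < e" if "0 < e" for e v w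
  proof -
    have "continuous_on S (?D v w)"
      by (intro smooth_on_imp_continuous_on smooth_on_frechet_derivative f)
    then have "isCont (?D v w) p"
      using S p by (simp add: continuous_on_eq_continuous_at)
    then show ?thesis
      using that unfolding continuous_at_eps_delta dist_real_def by blast
  qed
  have "\<bar>?D v w p - ?D w v p\<bar> < e + e" if e: "0 < e" for e
  proof -
    obtain d1 where d1: "d1 > 0" "\<And>q. dist q p < d1 \<Longrightarrow> \<bar>?D v w q - ?D v w p\<bar> < e"
      using close[OF e] by blast
    obtain d2 where d2: "d2 > 0" "\<And>q. dist q p < d2 \<Longrightarrow> \<bar>?D w v q - ?D w v p\<bar> < e"
      using close[OF e] by blast
    obtain d3 where d3: "d3 > 0" "\<And>q. dist q p < d3 \<Longrightarrow> q \<in> S"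
      using S p unfolding open_dist by blast
    define d where "d = min d1 (min d2 d3)"
    \<comment> \<open>This size keeps the whole parallelogram within distance d of p; the 1 covers
      the case that both directions vanish.\<close>
    define h where "h = d / (norm v + norm w + 1)"
    have d: "d > 0" using d1 d2 d3 by (simp add: d_def)
    have pos: "norm v + norm w + 1 > 0" by (simp add: add_nonneg_pos)
    have h: "h > 0" using d pos by (simp add: h_def)
    have near: "dist (p + s *\<^sub>R v + t *\<^sub>R w) p < d" if "0 \<le> s" "s \<le> h" "0 \<le> t" "t \<le> h" for s t
    proof -
      have "dist (p + s *\<^sub>R v + t *\<^sub>R w) p = norm (s *\<^sub>R v + t *\<^sub>R w)"
        by (simp add: dist_norm add.assoc)
      also have "\<dots> \<le> s * norm v + t * norm w"
        using norm_triangle_ineq[of "s *\<^sub>R v" "t *\<^sub>R w"] that by simp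
      also have "\<dots> \<le> h * norm v + h * norm w"
        using that by (intro add_mono mult_right_mono) auto
      also have "\<dots> < h * (norm v + norm w + 1)"
        using h by (simp add: algebra_simps)
      also have "\<dots> = d" using pos by (simp add: h_def)
      finally show ?thesis .
    qed
    have sub: "p + s *\<^sub>R v + t *\<^sub>R w \<in> S" "p + s *\<^sub>R w + t *\<^sub>R v \<in> S"
      if "0 \<le> s" "s \<le> h" "0 \<le> t" "t \<le> h" for s t
      using near[of s t] near[of t s] that d3(2)[of "p + s *\<^sub>R v + t *\<^sub>R w"]
        d3(2)[of "p + t *\<^sub>R v + s *\<^sub>R w"]
      by (auto simp: d_def add_ac)
    obtain s t where st: "0 < s" "s < h" "0 < t" "t < h"
      "f (p + h *\<^sub>R v + h *\<^sub>R w) - f (p + h *\<^sub>R v) - f (p + h *\<^sub>R w) + f p =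
        h * h * ?D v w (p + s *\<^sub>R v + t *\<^sub>R w)"
      using second_difference_eq[OF f h sub(1)] by blast
    obtain s' t' where st': "0 < s'" "s' < h" "0 < t'" "t' < h"
      "f (p + h *\<^sub>R w + h *\<^sub>R v) - f (p + h *\<^sub>R w) - f (p + h *\<^sub>R v) + f p =
        h * h * ?D w v (p + s' *\<^sub>R w + t' *\<^sub>R v)"
      using second_difference_eq[OF f h sub(2)] by blast
    have "h * h * ?D v w (p + s *\<^sub>R v + t *\<^sub>R w) = h * h * ?D w v (p + s' *\<^sub>R w + t' *\<^sub>R v)"
    proof -
      have "p + h *\<^sub>R w + h *\<^sub>R v = p + h *\<^sub>R v + h *\<^sub>R w" by simp
      with st(5) st'(5) show ?thesis by (simp only:)
    qed
    then have eq: "?D v w (p + s *\<^sub>R v + t *\<^sub>R w) = ?D w v (p + s' *\<^sub>R w + t' *\<^sub>R v)"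
      by (rule mult_left_cancel[THEN iffD1, rotated]) (use h in simp)
    have "\<bar>?D v w (p + s *\<^sub>R v + t *\<^sub>R w) - ?D v w p\<bar> < e"
      using near[of s t] st by (intro d1(2)) (simp add: d_def)
    moreover have "\<bar>?D w v (p + s' *\<^sub>R w + t' *\<^sub>R v) - ?D w v p\<bar> < e"
      using near[of t' s'] st' by (intro d2(2)) (simp add: d_def add_ac)
    ultimately show ?thesis using eq by linarith
  qed
  \<comment> \<open>With half the discrepancy as tolerance, a nonzero discrepancy would be smaller
    than itself.\<close>
  from this[of "\<bar>?D v w p - ?D w v p\<bar> / 2"] show ?thesis by fastforce
qed

section \<open>Smooth dependence of the inverse matrix on the matrix\<close>

lemma
  assumes "invertible A"
  shows matrix_inv_right: "A ** matrix_inv A = mat 1"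
    and matrix_inv_left: "matrix_inv A ** A = mat 1"
  using someI_ex[OF assms[unfolded invertible_def]] by (simp_all add: matrix_inv_def)

text \<open>Cramer's rule for the system whose right side is the b-th unit vector. It shows each
  entry of the inverse, which is defined by a choice, as a quotient of polynomials in the entries of
  A.\<close>

lemma matrix_inv_entry:
  fixes A :: "real^'k^'k"
  assumes "det A \<noteq> 0"
  shows "matrix_inv A $ a $ b = det (\<chi> i j. if j = a then axis b 1 $ i else A $ i $ j) / det A"
proof -
  have "A ** matrix_inv A = mat 1"
    using assms by (simp add: invertible_det_nz matrix_inv_right)
  then have "A *v (matrix_inv A *v axis b 1) = axis b 1"
    by (simp add: matrix_vector_mul_assoc)
  then have "matrix_inv A *v axis b 1 =
      (\<chi> k. det (\<chi> i j. if j = k then axis b 1 $ i else A $ i $ j) / det A)"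
    using cramer[OF assms] by blast
  then have "(matrix_inv A *v axis b 1) $ a =
      det (\<chi> i j. if j = a then axis b 1 $ i else A $ i $ j) / det A" by simp
  then show ?thesis by (simp add: matrix_vector_mult_basis column_def)
qed

lemma smooth_on_det:
  fixes M :: "'a::euclidean_space \<Rightarrow> real^'k^'k"
  assumes "open S" "\<And>i j. smooth_on S (\<lambda>p. M p $ i $ j)"
  shows "smooth_on S (\<lambda>p. det (M p))"
  unfolding det_def
  by (intro smooth_on_sum smooth_on_mult smooth_on_const smooth_on_prod assms)

lemma smooth_on_matrix_inv:
  fixes M :: "'a::euclidean_space \<Rightarrow> real^'k^'k"
  assumes S: "open S" and M: "\<And>i j. smooth_on S (\<lambda>p. M p $ i $ j)"
    and inv: "\<And>p. p \<in> S \<Longrightarrow> invertible (M p)"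
  shows "smooth_on S (\<lambda>p. matrix_inv (M p) $ a $ b)"
proof -
  have nz: "det (M p) \<noteq> 0" if "p \<in> S" for p
    using inv[OF that] by (simp add: invertible_det_nz)
  have "smooth_on S (\<lambda>p. (\<chi> i j. if j = a then axis b 1 $ i else M p $ i $ j) $ i $ j)" for i j
    using M by (cases "j = a") (simp_all add: smooth_on_const)
  then have "smooth_on S (\<lambda>p. det (\<chi> i j. if j = a then axis b 1 $ i else M p $ i $ j) *
      inverse (det (M p)))"
    by (intro smooth_on_mult smooth_on_inverse smooth_on_det S M nz) auto
  then show ?thesis
    by (rule smooth_on_cong[OF S]) (simp add: matrix_inv_entry nz divide_inverse)
qed

lemma sum_delta_mult:
  fixes f :: "'k::finite \<Rightarrow> real"
  shows "(\<Sum>a\<in>UNIV. f a * (if b = a then 1 else 0)) = f b"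
    and "(\<Sum>a\<in>UNIV. (if b = a then 1 else 0) * f a) = f b"
  by (simp_all add: if_distrib[of "\<lambda>r. r * _"] if_distrib[of "\<lambda>r. _ * r"] cong: if_cong)

lemma sum_rotate: "(\<Sum>a\<in>A. \<Sum>b\<in>B. \<Sum>c\<in>C. f a b c) = (\<Sum>c\<in>C. \<Sum>a\<in>A. \<Sum>b\<in>B. f a b c)"
  by (rule trans[OF _ sum.swap], rule sum.cong[OF refl], rule sum.swap)

section \<open>Directional derivatives in bundle coordinates\<close>

abbreviation dx :: "'k::finite \<Rightarrow> ('k tcoord \<Rightarrow> real) \<Rightarrow> 'k tcoord \<Rightarrow> real" where
  "dx a \<equiv> along (d_base a)"

abbreviation dy :: "'k::finite \<Rightarrow> ('k tcoord \<Rightarrow> real) \<Rightarrow> 'k tcoord \<Rightarrow> real" where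
  "dy a \<equiv> along (d_fibre a)"

lemma dx_eq: "dx a f = (\<lambda>p. frechet_derivative f (at p) (axis a 1, 0))"
  by (simp add: along_def d_base_def fun_eq_iff)

lemma dy_eq: "dy a f = (\<lambda>p. frechet_derivative f (at p) (0, axis a 1))"
  by (simp add: along_def d_fibre_def fun_eq_iff)

lemma smooth_on_dx: "smooth_on S f \<Longrightarrow> smooth_on S (dx a f)"
  unfolding dx_eq by (rule smooth_on_frechet_derivative)

lemma smooth_on_dy: "smooth_on S f \<Longrightarrow> smooth_on S (dy a f)"
  unfolding dy_eq by (rule smooth_on_frechet_derivative)

lemma smooth_on_snd_nth: "smooth_on S (\<lambda>p. snd p $ a)"
  by (intro smooth_on_bounded_linear bounded_linear_compose[OF bounded_linear_vec_nth]
      bounded_linear_snd)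

lemma along_eq: "(f has_derivative f') (at p) \<Longrightarrow> along X f p = f' (X p)"
  unfolding along_def using frechet_derivative_at by metis

text \<open>\<open>frechet_derivative\<close> chooses among the derivatives at \<open>p\<close>, and
  functions agreeing near \<open>p\<close> have the same ones, so the choices coincide even where
  there is none. This licenses differentiating identities that hold only on an open set.\<close>

lemma along_cong:
  assumes S: "open S" "p \<in> S" "\<And>q. q \<in> S \<Longrightarrow> f q = g q"
  shows "along X f p = along X g p"
proof -
  have "(f has_derivative D) (at p) \<longleftrightarrow> (g has_derivative D) (at p)" for D
    using has_derivative_transform_within_open[OF _ S(1,2)] S(3) by metis
  then show ?thesis by (simp add: along_def frechet_derivative_def)
qed

lemma along_add:
  "f differentiable at p \<Longrightarrow> g differentiable at p \<Longrightarrow>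
    along X (\<lambda>q. f q + g q) p = along X f p + along X g p"
  unfolding frechet_derivative_works
  by (drule (1) has_derivative_add, drule along_eq[of _ _ _ X]) (simp add: along_def)

lemma along_diff:
  "f differentiable at p \<Longrightarrow> g differentiable at p \<Longrightarrow>
    along X (\<lambda>q. f q - g q) p = along X f p - along X g p"
  unfolding frechet_derivative_works
  by (drule (1) has_derivative_diff, drule along_eq[of _ _ _ X]) (simp add: along_def)

lemma along_mult:
  "f differentiable at p \<Longrightarrow> g differentiable at p \<Longrightarrow>
    along X (\<lambda>q. f q * g q) p = along X f p * g p + f p * along X g p"
  unfolding frechet_derivative_works
  by (drule (1) has_derivative_mult, drule along_eq[of _ _ _ X]) (simp add: along_def)

lemma along_cmult: "f differentiable at p \<Longrightarrow> along X (\<lambda>q. c * f q) p = c * along X f p"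
  using along_mult[of "\<lambda>_. c" p f X] along_eq[OF has_derivative_const, of X c p] by simp

lemma along_sum:
  "(\<And>i. i \<in> I \<Longrightarrow> f i differentiable at p) \<Longrightarrow>
    along X (\<lambda>q. \<Sum>i\<in>I. f i q) p = (\<Sum>i\<in>I. along X (f i) p)"
  unfolding frechet_derivative_works
  by (drule has_derivative_sum, drule along_eq[of _ _ _ X]) (simp add: along_def)

lemma has_derivative_snd_nth:
  "((\<lambda>q. snd q $ c) has_derivative (\<lambda>q. snd q $ c)) (at p)"
  by (intro bounded_linear_imp_has_derivative bounded_linear_compose[OF bounded_linear_vec_nth]
      bounded_linear_snd)

lemma dx_snd_nth: "dx a (\<lambda>q. snd q $ c) p = 0"
  by (simp add: along_eq[OF has_derivative_snd_nth] d_base_def)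

lemma dy_snd_nth: "dy a (\<lambda>q. snd q $ c) p = (if a = c then 1 else 0)"
  by (simp add: along_eq[OF has_derivative_snd_nth] d_fibre_def axis_def)

lemma frechet_derivative_expand:
  fixes f :: "'k::finite tcoord \<Rightarrow> real"
  assumes "f differentiable at p"
  shows "frechet_derivative f (at p) v =
    (\<Sum>a\<in>UNIV. fst v $ a * dx a f p) + (\<Sum>a\<in>UNIV. snd v $ a * dy a f p)"
proof -
  have lin: "linear (frechet_derivative f (at p))" by (rule linear_frechet_derivative[OF assms])
  have v: "v = (\<Sum>a\<in>UNIV. fst v $ a *\<^sub>R (axis a 1, 0)) + (\<Sum>a\<in>UNIV. snd v $ a *\<^sub>R (0, axis a 1))"
    using basis_expansion[of "fst v"] basis_expansion[of "snd v"]
    by (simp add: prod_eq_iff fst_sum snd_sum scalar_mult_eq_scaleR)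
  show ?thesis
    unfolding dx_eq dy_eq
    by (subst v) (simp only: linear_add[OF lin] linear_sum[OF lin] linear_cmul[OF lin] real_scaleR_def)
qed

lemma along_compose:
  fixes \<phi> :: "'m::finite tcoord \<Rightarrow> 'n::finite tcoord"
  assumes "f differentiable at (\<phi> p)" "\<phi> differentiable at p"
  shows "along X (\<lambda>q. f (\<phi> q)) p =
    (\<Sum>a\<in>UNIV. along X (\<lambda>q. fst (\<phi> q) $ a) p * dx a f (\<phi> p)) +
    (\<Sum>a\<in>UNIV. along X (\<lambda>q. snd (\<phi> q) $ a) p * dy a f (\<phi> p))"
proof -
  let ?D = "frechet_derivative \<phi> (at p)"
  have \<phi>: "(\<phi> has_derivative ?D) (at p)" using assms(2) frechet_derivative_works by blast
  have f: "(f has_derivative frechet_derivative f (at (\<phi> p))) (at (\<phi> p))"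
    using assms(1) frechet_derivative_works by blast
  have 1: "along X (\<lambda>q. fst (\<phi> q) $ a) p = fst (?D (X p)) $ a"
    and 2: "along X (\<lambda>q. snd (\<phi> q) $ a) p = snd (?D (X p)) $ a" for a
    by (intro along_eq bounded_linear.has_derivative[OF _ \<phi>]
        bounded_linear_compose[OF bounded_linear_vec_nth] bounded_linear_fst bounded_linear_snd)+
  have "along X (\<lambda>q. f (\<phi> q)) p = frechet_derivative f (at (\<phi> p)) (?D (X p))"
    using along_eq[OF has_derivative_compose[OF \<phi> f]] .
  then show ?thesis
    by (simp only: frechet_derivative_expand[OF assms(1)] 1 2)
qed

lemma dx_dx_commute: "open S \<Longrightarrow> smooth_on S f \<Longrightarrow> p \<in> S \<Longrightarrow> dx a (dx b f) p = dx b (dx a f) p"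
  and dy_dy_commute: "open S \<Longrightarrow> smooth_on S f \<Longrightarrow> p \<in> S \<Longrightarrow> dy a (dy b f) p = dy b (dy a f) p"
  by (simp_all only: dx_eq dy_eq frechet_derivative_commute)

lemma has_derivative_compose_fst:
  assumes "h differentiable at (fst p)"
  shows "((\<lambda>q. h (fst q)) has_derivative (\<lambda>v. frechet_derivative h (at (fst p)) (fst v))) (at p)"
  by (rule has_derivative_compose[OF has_derivative_fst[OF has_derivative_ident]])
    (use assms frechet_derivative_works in blast)

lemma dx_compose_fst:
  "h differentiable at (fst p) \<Longrightarrow>
    dx a (\<lambda>q. h (fst q)) p = frechet_derivative h (at (fst p)) (axis a 1)"
  using along_eq[OF has_derivative_compose_fst] by (fastforce simp: d_base_def)

lemma dy_compose_fst: "h differentiable at (fst p) \<Longrightarrow> dy a (\<lambda>q. h (fst q)) p = 0"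
  using along_eq[OF has_derivative_compose_fst, of h p "d_fibre a"]
    linear_0[OF linear_frechet_derivative, of h "at (fst p)"]
  by (simp add: d_fibre_def)

lemma smooth_on_tcoordI:
  fixes \<phi> :: "'a::euclidean_space \<Rightarrow> 'k::finite tcoord"
  assumes S: "open S" and "\<And>a. smooth_on S (\<lambda>p. fst (\<phi> p) $ a)" "\<And>a. smooth_on S (\<lambda>p. snd (\<phi> p) $ a)"
  shows "smooth_on S \<phi>"
proof -
  have "smooth_on S (\<lambda>p. (\<Sum>a\<in>UNIV. fst (\<phi> p) $ a *\<^sub>R (axis a 1, 0)) +
      (\<Sum>a\<in>UNIV. snd (\<phi> p) $ a *\<^sub>R (0, axis a 1)) :: 'k tcoord)"
    by (intro smooth_on_add smooth_on_sum smooth_on_scaleR smooth_on_const assms)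
  moreover have "(\<Sum>a\<in>UNIV. fst v $ a *\<^sub>R (axis a 1, 0)) + (\<Sum>a\<in>UNIV. snd v $ a *\<^sub>R (0, axis a 1)) = v"
    for v :: "'k tcoord"
    using basis_expansion[of "fst v"] basis_expansion[of "snd v"]
    by (simp add: prod_eq_iff fst_sum snd_sum scalar_mult_eq_scaleR)
  ultimately show ?thesis by simp
qed

subsection \<open>Functions homogeneous along the fibres\<close>

text \<open>Only positive factors and nonzero vectors occur, as a Finsler function may be
  irreversible and is smooth only off the null section. Natural degrees cover L, its fibre
  derivatives and g, of degrees 2, 1 and 0.\<close>

definition fibre_homogeneous :: "nat \<Rightarrow> (real^'k) set \<Rightarrow> ('k::finite tcoord \<Rightarrow> real) \<Rightarrow> bool" where
  "fibre_homogeneous k U f \<longleftrightarrow>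
    (\<forall>x\<in>U. \<forall>y. y \<noteq> 0 \<longrightarrow> (\<forall>t>0. f (x, t *\<^sub>R y) = t ^ k * f (x, y)))"

lemma fibre_homogeneousD:
  "fibre_homogeneous k U f \<Longrightarrow> x \<in> U \<Longrightarrow> y \<noteq> 0 \<Longrightarrow> 0 < t \<Longrightarrow> f (x, t *\<^sub>R y) = t ^ k * f (x, y)"
  by (simp add: fibre_homogeneous_def)

text \<open>The homogeneity relation is differentiated in (x, y) with t fixed. Purely horizontal
  vectors keep the degree; for vertical ones linearity releases a factor t, which lowers the degree
  by one.\<close>

lemma frechet_derivative_fibre_homogeneous:
  fixes f :: "'k::finite tcoord \<Rightarrow> real"
  assumes U: "open U" and f: "smooth_on (U \<times> -{0}) f" and hom: "fibre_homogeneous k U f"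
    and x: "x \<in> U" and y: "y \<noteq> 0" and t: "0 < t"
  shows "frechet_derivative f (at (x, t *\<^sub>R y)) (\<xi>, t *\<^sub>R \<eta>) =
    t ^ k * frechet_derivative f (at (x, y)) (\<xi>, \<eta>)"
proof -
  let ?m = "\<lambda>q. (fst q, t *\<^sub>R snd q)"
  have S: "open (U \<times> -{0::real^'k})" by (intro open_Times U open_Compl closed_singleton)
  have "(?m has_derivative ?m) (at (x, y))"
    by (auto intro!: derivative_eq_intros)
  moreover have "(f has_derivative frechet_derivative f (at (x, t *\<^sub>R y))) (at (?m (x, y)))"
    using smooth_on_imp_has_derivative[OF f, of "(x, t *\<^sub>R y)"] x y t by simp
  ultimately have 1: "((\<lambda>q. f (?m q)) has_derivative
      (\<lambda>v. frechet_derivative f (at (x, t *\<^sub>R y)) (?m v))) (at (x, y))"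
    using has_derivative_compose by blast
  have "((\<lambda>q. t ^ k * f q) has_derivative (\<lambda>v. t ^ k * frechet_derivative f (at (x, y)) v)) (at (x, y))"
    using smooth_on_imp_has_derivative[OF f, of "(x, y)"] x y
    by (intro has_derivative_mult_right) simp
  then have 2: "((\<lambda>q. f (?m q)) has_derivative (\<lambda>v. t ^ k * frechet_derivative f (at (x, y)) v)) (at (x, y))"
    by (rule has_derivative_transform_within_open[OF _ S])
      (use x y t in \<open>auto intro: fibre_homogeneousD[OF hom, symmetric]\<close>)
  show ?thesis
    using fun_cong[OF has_derivative_unique[OF 1 2], of "(\<xi>, \<eta>)"] by simp
qed

lemma fibre_homogeneous_dx:
  assumes "open U" "smooth_on (U \<times> -{0}) f" "fibre_homogeneous k U f"
  shows "fibre_homogeneous k U (dx a f)"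
  unfolding fibre_homogeneous_def dx_eq
  using frechet_derivative_fibre_homogeneous[OF assms, where \<eta> = 0] by simp

lemma fibre_homogeneous_dy:
  assumes U: "open U" and f: "smooth_on (U \<times> -{0}) f" and hom: "fibre_homogeneous (Suc k) U f"
  shows "fibre_homogeneous k U (dy a f)"
proof -
  have "dy a f (x, t *\<^sub>R y) = t ^ k * dy a f (x, y)"
    if "x \<in> U" "y \<noteq> 0" "0 < t" for x y t
  proof -
    have "linear (frechet_derivative f (at (x, t *\<^sub>R y)))"
      using that by (intro linear_frechet_derivative smooth_on_imp_differentiable[OF f]) simp
    from linear_cmul[OF this, of t "(0, axis a 1)"]
      frechet_derivative_fibre_homogeneous[OF assms that, of 0 "axis a 1"]
    show ?thesis using that(3) by (simp add: dy_eq)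
  qed
  then show ?thesis by (simp add: fibre_homogeneous_def)
qed

text \<open>The ray through y is followed: both sides are the derivative at t = 1 of f (x, t y), by
  the chain rule and as a power of t.\<close>

lemma euler_fibre_homogeneous:
  assumes f: "smooth_on (U \<times> -{0}) f" and hom: "fibre_homogeneous k U f"
    and p: "p \<in> U \<times> -{0}"
  shows "(\<Sum>a\<in>UNIV. snd p $ a * dy a f p) = real k * f p"
proof -
  obtain x y where xy: "p = (x, y)" "x \<in> U" "y \<noteq> 0" using p by auto
  have d: "f differentiable at p" by (rule smooth_on_imp_differentiable[OF f p])
  have "((\<lambda>t. (x, t *\<^sub>R y)) has_derivative (\<lambda>r. (0, r *\<^sub>R y))) (at (1::real))"
    by (auto intro!: derivative_eq_intros)
  from has_derivative_compose[OF this, of f] d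
  have 1: "((\<lambda>t. f (x, t *\<^sub>R y)) has_derivative (\<lambda>r. frechet_derivative f (at p) (0, r *\<^sub>R y))) (at 1)"
    by (simp add: xy frechet_derivative_works)
  have "((\<lambda>t. t ^ k * f p) has_derivative (\<lambda>r. real k * r * f p)) (at (1::real))"
    by (auto intro!: derivative_eq_intros)
  then have 2: "((\<lambda>t. f (x, t *\<^sub>R y)) has_derivative (\<lambda>r. real k * r * f p)) (at 1)"
    by (rule has_derivative_transform_within_open[of _ _ _ _ "{0<..}"])
      (use fibre_homogeneousD[OF hom xy(2,3)] in \<open>auto simp: xy(1)\<close>)
  have "frechet_derivative f (at p) (0, y) = real k * f p"
    using fun_cong[OF has_derivative_unique[OF 1 2], of 1] by simp
  then show ?thesis
    using frechet_derivative_expand[OF d, of "(0, y)"] by (simp add: xy(1))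
qed

section \<open>The spray and the Cartan nonlinear connection of a Finsler function\<close>

text \<open>The Christoffel symbols and the connection differentiate, so agreement on an open set is
  required. It transfers results from the Hessian of the restricted function to
  \<open>induced_tensor\<close>.\<close>

lemma cartan_nlc_cong:
  assumes S: "open S" and gh: "\<And>a b q. q \<in> S \<Longrightarrow> g a b q = h a b q" and p: "p \<in> S"
  shows "spray g a p = spray h a p" and "cartan_nlc g a b p = cartan_nlc h a b p"
proof -
  have "christoffel g a b c q = christoffel h a b c q" if "q \<in> S" for a b c q
    using that gh along_cong[OF S that, of "g _ _" "h _ _"]
    by (simp add: christoffel_def inv_tensor_def)
  then have spray: "spray g a q = spray h a q" if "q \<in> S" for a q
    using that by (simp add: spray_def)
  then show "spray g a p = spray h a p" using p by blast
  show "cartan_nlc g a b p = cartan_nlc h a b p"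
    unfolding cartan_nlc_def using spray by (rule along_cong[OF S p])
qed

text \<open>A Finsler function in a single bundle chart. Isolating these properties lets the same
  theory serve the ambient function and, as \<open>sub\<close>, its restriction to the
  submanifold.\<close>

locale finsler_coord =
  fixes U :: "(real^'k::finite) set" and F :: "'k tcoord \<Rightarrow> real"
  assumes open_U: "open U"
    and smooth_F: "smooth_on (U \<times> -{0}) F"
    and homogeneous_F: "fibre_homogeneous 1 U F"
    and positive: "\<And>p w. p \<in> U \<times> -{0} \<Longrightarrow> w \<noteq> 0 \<Longrightarrow>
      (\<Sum>a\<in>UNIV. \<Sum>b\<in>UNIV. fund_tensor F a b p * w $ a * w $ b) > 0"
begin

abbreviation S where "S \<equiv> U \<times> -{0 :: real^'k}"
abbreviation L where "L \<equiv> \<lambda>q. (F q)\<^sup>2"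
abbreviation g where "g \<equiv> fund_tensor F"
abbreviation G where "G \<equiv> spray g"
abbreviation N where "N \<equiv> cartan_nlc g"

lemma open_S: "open S"
  by (intro open_Times open_U open_Compl closed_singleton)

lemma smooth_L: "smooth_on S L"
  unfolding power2_eq_square by (intro smooth_on_mult open_S smooth_F)

lemma homogeneous_L: "fibre_homogeneous 2 U L"
  using homogeneous_F by (simp add: fibre_homogeneous_def power_mult_distrib)

lemma g_eq: "g a b = (\<lambda>p. 1/2 * dy a (dy b L) p)"
  by (simp add: fund_tensor_def fun_eq_iff)

lemma smooth_g: "smooth_on S (g a b)"
  unfolding g_eq by (intro smooth_on_mult smooth_on_const smooth_on_dy smooth_L open_S)

lemma g_sym: "p \<in> S \<Longrightarrow> g a b p = g b a p"
  by (simp add: g_eq dy_dy_commute[OF open_S smooth_L])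

lemma homogeneous_dy_L: "fibre_homogeneous 1 U (dy a L)"
  by (rule fibre_homogeneous_dy[OF open_U smooth_L])
    (use homogeneous_L in \<open>simp add: numeral_2_eq_2\<close>)

lemma homogeneous_g: "fibre_homogeneous 0 U (g a b)"
proof -
  have "fibre_homogeneous 0 U (dy a (dy b L))"
    by (rule fibre_homogeneous_dy[OF open_U smooth_on_dy[OF smooth_L]])
      (use homogeneous_dy_L in simp)
  then show ?thesis by (simp add: fibre_homogeneous_def g_eq)
qed

text \<open>Euler's relation for \<open>dy a L\<close>, of degree 1, after the symmetry of
  \<open>g\<close> has made the summed index the outer fibre derivative.\<close>

lemma g_y: assumes p: "p \<in> S" shows "(\<Sum>b\<in>UNIV. g a b p * snd p $ b) = 1/2 * dy a L p"
proof -
  have "g a b p * snd p $ b = 1/2 * (snd p $ b * dy b (dy a L) p)" for b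
    by (subst g_sym[OF p]) (simp add: g_eq)
  then have "(\<Sum>b\<in>UNIV. g a b p * snd p $ b) = 1/2 * (\<Sum>b\<in>UNIV. snd p $ b * dy b (dy a L) p)"
    by (simp only: sum_distrib_left)
  also have "\<dots> = 1/2 * dy a L p"
    using euler_fibre_homogeneous[OF smooth_on_dy[OF smooth_L] homogeneous_dy_L p] by simp
  finally show ?thesis .
qed

lemma g_yy: assumes p: "p \<in> S" shows "(\<Sum>a\<in>UNIV. \<Sum>b\<in>UNIV. g a b p * snd p $ a * snd p $ b) = L p"
proof -
  have "(\<Sum>a\<in>UNIV. \<Sum>b\<in>UNIV. g a b p * snd p $ a * snd p $ b) =
      (\<Sum>a\<in>UNIV. snd p $ a * (\<Sum>b\<in>UNIV. g a b p * snd p $ b))"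
    by (simp add: sum_distrib_left mult_ac)
  also have "\<dots> = 1/2 * (\<Sum>a\<in>UNIV. snd p $ a * dy a L p)"
    by (simp only: g_y[OF p]) (simp add: sum_distrib_left mult_ac)
  also have "\<dots> = L p"
    using euler_fibre_homogeneous[OF smooth_L homogeneous_L p] by simp
  finally show ?thesis .
qed

text \<open>A vector in the kernel makes the quadratic form vanish, so definiteness leaves only
  zero.\<close>

lemma invertible_g: assumes "p \<in> S" shows "invertible (\<chi> i j. g i j p)"
proof -
  have "w = 0" if w: "(\<chi> i j. g i j p) *v w = 0" for w
  proof (rule ccontr)
    assume "w \<noteq> 0"
    from positive[OF assms this]
    have "0 < (\<Sum>a\<in>UNIV. w $ a * ((\<chi> i j. g i j p) *v w) $ a)"
      by (simp add: matrix_vector_mult_def sum_distrib_left mult_ac)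
    then show False by (simp add: w)
  qed
  then show ?thesis
    using invertible_left_inverse matrix_left_invertible_ker by blast
qed

lemma g_inv: "p \<in> S \<Longrightarrow> (\<Sum>b\<in>UNIV. g a b p * inv_tensor g b d p) = (if a = d then 1 else 0)"
  using arg_cong[OF matrix_inv_right[OF invertible_g], of p "\<lambda>M. M $ a $ d"]
  by (simp add: inv_tensor_def matrix_matrix_mult_def mat_def)

lemma inv_g: "p \<in> S \<Longrightarrow> (\<Sum>b\<in>UNIV. inv_tensor g a b p * g b d p) = (if a = d then 1 else 0)"
  using arg_cong[OF matrix_inv_left[OF invertible_g], of p "\<lambda>M. M $ a $ d"]
  by (simp add: inv_tensor_def matrix_matrix_mult_def mat_def)

lemma solve_g:
  assumes p: "p \<in> S" and X: "\<And>a. (\<Sum>b\<in>UNIV. g a b p * X b) = Y a"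
  shows "X a = (\<Sum>b\<in>UNIV. inv_tensor g a b p * Y b)"
proof -
  have "(\<Sum>b\<in>UNIV. inv_tensor g a b p * Y b) =
      (\<Sum>d\<in>UNIV. (\<Sum>b\<in>UNIV. inv_tensor g a b p * g b d p) * X d)"
    unfolding X[symmetric] sum_distrib_left sum_distrib_right
    by (subst sum.swap) (simp only: mult.assoc)
  also have "\<dots> = X a"
    by (simp add: inv_g[OF p] sum_delta_mult)
  finally show ?thesis by simp
qed

lemma smooth_inv: "smooth_on S (inv_tensor g a b)"
  unfolding inv_tensor_def[abs_def]
  by (rule smooth_on_matrix_inv[OF open_S]) (simp_all add: smooth_g invertible_g)

lemma smooth_spray: "smooth_on S (G a)"
  unfolding spray_def[abs_def] christoffel_def
  by (intro smooth_on_mult smooth_on_sum smooth_on_add smooth_on_diff open_S smooth_on_const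
      smooth_inv smooth_on_dx smooth_g smooth_on_snd_nth)

lemma smooth_N: "smooth_on S (N a b)"
  unfolding cartan_nlc_def by (intro smooth_on_dy smooth_spray)

text \<open>The degree comes from the two explicit fibre coordinates alone: \<open>g\<close>, its
  inverse and its base derivatives have degree 0.\<close>

lemma homogeneous_spray: "fibre_homogeneous 2 U (G a)"
proof -
  have "G a (x, t *\<^sub>R y) = t\<^sup>2 * G a (x, y)" if xyt: "x \<in> U" "y \<noteq> 0" "0 < t" for x y t
  proof -
    note hom = fibre_homogeneousD[OF _ xyt, of 0, simplified]
    have [simp]: "g a b (x, t *\<^sub>R y) = g a b (x, y)" for a b
      by (intro hom homogeneous_g)
    have [simp]: "dx c (g a b) (x, t *\<^sub>R y) = dx c (g a b) (x, y)" for a b c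
      by (intro hom fibre_homogeneous_dx open_U smooth_g homogeneous_g)
    have "christoffel g a b c (x, t *\<^sub>R y) = christoffel g a b c (x, y)" for b c
      by (simp add: christoffel_def inv_tensor_def)
    then show ?thesis
      by (simp add: spray_def sum_distrib_left power2_eq_square mult_ac)
  qed
  then show ?thesis by (simp add: fibre_homogeneous_def)
qed

lemma N_y: "p \<in> S \<Longrightarrow> (\<Sum>b\<in>UNIV. N a b p * snd p $ b) = 2 * G a p"
  using euler_fibre_homogeneous[OF smooth_spray homogeneous_spray]
  by (simp add: cartan_nlc_def mult.commute)

text \<open>Fibre coordinates are constant under base derivatives, so \<open>g_y\<close> and
  \<open>g_yy\<close> may be differentiated in x; this turns contractions of derivatives of g with y
  into derivatives of L. The factor 1/4 is the 1/2 of the spray times the 1/2 of the Christoffel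
  symbols.\<close>

lemma lower_spray:
  assumes p: "p \<in> S"
  shows "(\<Sum>e\<in>UNIV. g a e p * G e p) =
    1/4 * ((\<Sum>b\<in>UNIV. snd p $ b * dx b (dy a L) p) - dx a L p)"
proof -
  note diff = smooth_on_imp_differentiable[OF _ p]
  have ds: "(\<lambda>q. snd q $ b) differentiable at p" for b by (rule diff[OF smooth_on_snd_nth])
  define y where "y = snd p"
  define dg where "dg b a c = dx b (g a c) p" for a b c
  have A: "(\<Sum>c\<in>UNIV. dg b a c * y $ c) = 1/2 * dx b (dy a L) p" for a b
  proof -
    have "dx b (\<lambda>q. \<Sum>c\<in>UNIV. g a c q * snd q $ c) p = dx b (\<lambda>q. 1/2 * dy a L q) p"
      by (rule along_cong[OF open_S p g_y])
    also have "\<dots> = 1/2 * dx b (dy a L) p"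
      by (intro along_cmult diff smooth_on_dy smooth_L)
    finally show ?thesis
      by (simp add: along_sum along_mult dx_snd_nth dg_def y_def diff[OF smooth_g] ds)
  qed
  have B: "(\<Sum>b\<in>UNIV. \<Sum>c\<in>UNIV. dg a b c * y $ b * y $ c) = dx a L p"
  proof -
    have "dx a (\<lambda>q. \<Sum>b\<in>UNIV. \<Sum>c\<in>UNIV. g b c q * snd q $ b * snd q $ c) p = dx a L p"
      by (rule along_cong[OF open_S p g_yy])
    then show ?thesis
      by (simp add: along_sum along_mult dx_snd_nth dg_def y_def diff[OF smooth_g] ds)
  qed
  let ?c = "\<lambda>d b c. dg b d c + dg c d b - dg d b c"
  have "(\<Sum>e\<in>UNIV. g a e p * G e p) = 1/4 * (\<Sum>d\<in>UNIV. (\<Sum>e\<in>UNIV. g a e p * inv_tensor g e d p) *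
      (\<Sum>b\<in>UNIV. \<Sum>c\<in>UNIV. ?c d b c * y $ b * y $ c))"
  proof -
    have "G e p = 1/4 * (\<Sum>d\<in>UNIV. inv_tensor g e d p *
        (\<Sum>b\<in>UNIV. \<Sum>c\<in>UNIV. ?c d b c * y $ b * y $ c))" for e
    proof -
      have "G e p = 1/4 * (\<Sum>b\<in>UNIV. \<Sum>c\<in>UNIV. \<Sum>d\<in>UNIV.
          inv_tensor g e d p * (?c d b c * y $ b * y $ c))"
        by (simp add: spray_def christoffel_def sum_distrib_left sum_distrib_right
            dg_def y_def mult_ac)
      also have "\<dots> = 1/4 * (\<Sum>d\<in>UNIV. \<Sum>b\<in>UNIV. \<Sum>c\<in>UNIV.
          inv_tensor g e d p * (?c d b c * y $ b * y $ c))"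
        by (subst sum.swap[of _ _ "UNIV :: 'k set"], subst sum.swap, rule refl)
      finally show ?thesis by (simp only: sum_distrib_left)
    qed
    then have "(\<Sum>e\<in>UNIV. g a e p * G e p) = 1/4 * (\<Sum>e\<in>UNIV. \<Sum>d\<in>UNIV.
        g a e p * inv_tensor g e d p * (\<Sum>b\<in>UNIV. \<Sum>c\<in>UNIV. ?c d b c * y $ b * y $ c))"
      by (simp add: sum_distrib_left mult.assoc mult.left_commute)
    then show ?thesis
      by (subst (asm) sum.swap) (simp only: sum_distrib_right)
  qed
  also have "\<dots> = 1/4 * (\<Sum>b\<in>UNIV. \<Sum>c\<in>UNIV. ?c a b c * y $ b * y $ c)"
    by (simp add: g_inv[OF p] sum_delta_mult)
  \<comment> \<open>The first two sums on the right differ only in the name of the index; by A each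
    supplies half of the mixed derivative term, and B evaluates the third.\<close>
  also have "(\<Sum>b\<in>UNIV. \<Sum>c\<in>UNIV. ?c a b c * y $ b * y $ c) =
      (\<Sum>b\<in>UNIV. y $ b * (\<Sum>c\<in>UNIV. dg b a c * y $ c)) +
      (\<Sum>c\<in>UNIV. y $ c * (\<Sum>b\<in>UNIV. dg c a b * y $ b)) -
      (\<Sum>b\<in>UNIV. \<Sum>c\<in>UNIV. dg a b c * y $ b * y $ c)"
  proof -
    have swap: "(\<Sum>b\<in>UNIV. \<Sum>c\<in>UNIV. dg c a b * y $ b * y $ c) =
        (\<Sum>c\<in>UNIV. \<Sum>b\<in>UNIV. dg c a b * y $ b * y $ c)" by (rule sum.swap)
    have "(\<Sum>b\<in>UNIV. \<Sum>c\<in>UNIV. ?c a b c * y $ b * y $ c) =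
        (\<Sum>b\<in>UNIV. \<Sum>c\<in>UNIV. dg b a c * y $ b * y $ c) +
        (\<Sum>b\<in>UNIV. \<Sum>c\<in>UNIV. dg c a b * y $ b * y $ c) -
        (\<Sum>b\<in>UNIV. \<Sum>c\<in>UNIV. dg a b c * y $ b * y $ c)"
      by (simp add: left_diff_distrib distrib_right sum.distrib sum_subtractf)
    then show ?thesis
      unfolding swap by (simp add: sum_distrib_left mult_ac)
  qed
  finally show ?thesis
    unfolding A B by (simp add: y_def sum_divide_distrib[symmetric])
qed

end

section \<open>Immersed submanifolds\<close>

text \<open>The rank condition appears as injectivity on tangent vectors. In this form it keeps
  lifts of nonzero vectors off the null section and makes the induced tensor definite.\<close>

locale finsler_immersion = finsler_coord U F
  for U :: "(real^'n::finite) set" and F :: "'n tcoord \<Rightarrow> real" +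
  fixes U' :: "(real^'m::finite) set" and x :: "real^'m \<Rightarrow> real^'n"
  assumes open_U': "open U'"
    and smooth_x: "smooth_on U' x"
    and image_x: "x ` U' \<subseteq> U"
    and immersive: "\<And>u w. u \<in> U' \<Longrightarrow> jacobian x (at u) *v w = 0 \<Longrightarrow> w = 0"
begin

abbreviation S' where "S' \<equiv> U' \<times> -{0 :: real^'m}"

lemma open_S': "open S'"
  by (intro open_Times open_U' open_Compl closed_singleton)

lemma fst_S': "p \<in> S' \<Longrightarrow> fst p \<in> U'"
  by auto

lemma smooth_on_compose_fst:
  "smooth_on U' (h :: real^'m \<Rightarrow> real) \<Longrightarrow> smooth_on S' (\<lambda>p. h (fst p))"
  by (rule smooth_on_compose[OF open_S', where g = fst and R = U'])
    (auto intro: smooth_on_bounded_linear bounded_linear_fst)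

lemma smooth_jacobian: "smooth_on U' (\<lambda>u. jacobian x (at u) $ a $ \<alpha>)"
  unfolding jacobian_def matrix_def
  by (simp, intro smooth_on_bounded_linear_compose[where h = "\<lambda>v. v $ a"] open_U' bounded_linear_vec_nth
      smooth_on_frechet_derivative smooth_x)

lemma smooth_B1: "smooth_on S' (B1 x a \<alpha>)"
  unfolding B1_def[abs_def] by (rule smooth_on_compose_fst[OF smooth_jacobian])

lemma smooth_B2: "smooth_on S' (B2 x a \<alpha> \<beta>)"
  unfolding B2_def by (intro smooth_on_dx smooth_B1)

lemma smooth_B0: "smooth_on S' (B0 x a \<beta>)"
  unfolding B0_def[abs_def]
  by (intro smooth_on_sum smooth_on_mult open_S' smooth_B2 smooth_on_snd_nth)

lemma fst_lift: "fst (lift x p) $ a = x (fst p) $ a"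
  by (simp add: lift_def)

lemma snd_lift: "snd (lift x p) $ a = (\<Sum>\<alpha>\<in>UNIV. B1 x a \<alpha> p * snd p $ \<alpha>)"
  by (simp add: lift_def B1_def matrix_vector_mult_def)

lemma lift_in: "p \<in> S' \<Longrightarrow> lift x p \<in> S"
  using image_x immersive by (auto simp: lift_def)

lemma smooth_x_nth: "smooth_on U' (\<lambda>u. x u $ a)"
  by (intro smooth_on_bounded_linear_compose[where h = "\<lambda>v. v $ a"] open_U' bounded_linear_vec_nth smooth_x)

lemma smooth_lift: "smooth_on S' (lift x)"
  by (rule smooth_on_tcoordI[OF open_S']; unfold fst_lift snd_lift)
    (intro smooth_on_compose_fst smooth_x_nth smooth_on_sum smooth_on_mult open_S' smooth_B1
      smooth_on_snd_nth)+

lemma smooth_on_compose_lift: "smooth_on S f \<Longrightarrow> smooth_on S' (\<lambda>q. f (lift x q))"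
  by (erule smooth_on_compose[OF open_S' _ smooth_lift]) (intro image_subsetI lift_in)

lemma dx_x: assumes "p \<in> S'" shows "dx \<alpha> (\<lambda>q. x (fst q) $ a) p = B1 x a \<alpha> p"
proof -
  have "(x has_derivative frechet_derivative x (at (fst p))) (at (fst p))"
    by (rule smooth_on_imp_has_derivative[OF smooth_x fst_S'[OF assms]])
  from bounded_linear.has_derivative[OF bounded_linear_vec_nth this, of a]
  have "frechet_derivative (\<lambda>u. x u $ a) (at (fst p)) = (\<lambda>v. frechet_derivative x (at (fst p)) v $ a)"
    by (rule frechet_derivative_at[symmetric])
  then show ?thesis
    using dx_compose_fst[OF smooth_on_imp_differentiable[OF smooth_x_nth fst_S'[OF assms]]]
    by (simp add: B1_def jacobian_def matrix_def)
qed

text \<open>On the open set \<open>S'\<close> both sides are second base derivatives of one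
  function, the coordinate x^a of the immersion.\<close>

lemma B2_sym: assumes "p \<in> S'" shows "B2 x a \<alpha> \<beta> p = B2 x a \<beta> \<alpha> p"
proof -
  have "B2 x a \<alpha> \<beta> p = dx \<alpha> (dx \<beta> (\<lambda>q. x (fst q) $ a)) p" for \<alpha> \<beta>
    unfolding B2_def by (rule along_cong[OF open_S' assms]) (simp add: dx_x)
  then show ?thesis
    using dx_dx_commute[OF open_S' smooth_on_compose_fst[OF smooth_x_nth] assms] by simp
qed

lemma dy_B1: "p \<in> S' \<Longrightarrow> dy \<gamma> (B1 x a \<alpha>) p = 0"
  unfolding B1_def[abs_def]
  by (intro dy_compose_fst smooth_on_imp_differentiable[OF smooth_jacobian]) auto

lemma dy_B2: assumes "p \<in> S'" shows "dy \<gamma> (B2 x a \<alpha> \<beta>) p = 0"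
proof -
  let ?h = "\<lambda>u. frechet_derivative (\<lambda>u. jacobian x (at u) $ a $ \<beta>) (at u) (axis \<alpha> 1)"
  have "dy \<gamma> (B2 x a \<alpha> \<beta>) p = dy \<gamma> (\<lambda>q. ?h (fst q)) p"
    unfolding B2_def B1_def[abs_def]
    by (rule along_cong[OF open_S' assms])
      (intro dx_compose_fst smooth_on_imp_differentiable[OF smooth_jacobian] fst_S')
  also have "\<dots> = 0"
    by (intro dy_compose_fst fst_S' assms
        smooth_on_imp_differentiable[OF smooth_on_frechet_derivative[OF smooth_jacobian]])
  finally show ?thesis .
qed

lemma dy_B0: assumes p: "p \<in> S'" shows "dy \<gamma> (B0 x a \<beta>) p = B2 x a \<gamma> \<beta> p"
  unfolding B0_def[abs_def]
  by (simp add: along_sum along_mult smooth_on_imp_differentiable[OF smooth_B2 p]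
      smooth_on_imp_differentiable[OF smooth_on_snd_nth p] dy_B2[OF p] dy_snd_nth sum_delta_mult)

lemma dx_snd_lift: assumes p: "p \<in> S'" shows "dx \<beta> (\<lambda>q. snd (lift x q) $ a) p = B0 x a \<beta> p"
proof -
  have "dx \<beta> (\<lambda>q. snd (lift x q) $ a) p = (\<Sum>\<alpha>\<in>UNIV. B2 x a \<beta> \<alpha> p * snd p $ \<alpha>)"
    unfolding snd_lift
    by (simp add: along_sum along_mult smooth_on_imp_differentiable[OF smooth_B1 p]
        smooth_on_imp_differentiable[OF smooth_on_snd_nth p] dx_snd_nth B2_def)
  then show ?thesis
    by (simp only: B0_def B2_sym[OF p, of a \<beta>])
qed

lemma dy_snd_lift: assumes p: "p \<in> S'" shows "dy \<beta> (\<lambda>q. snd (lift x q) $ a) p = B1 x a \<beta> p"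
  unfolding snd_lift
  by (simp add: along_sum along_mult smooth_on_imp_differentiable[OF smooth_B1 p]
      smooth_on_imp_differentiable[OF smooth_on_snd_nth p] dy_snd_nth dy_B1[OF p] sum_delta_mult)

text \<open>Moving the base point also changes the fibre coordinate y = B(u) v, whence the
  \<open>B0\<close> terms; a move along the fibre leaves x fixed and changes y by B.\<close>

lemma
  assumes f: "smooth_on S f" and p: "p \<in> S'"
  shows dx_lift: "dx \<beta> (\<lambda>q. f (lift x q)) p =
      (\<Sum>a\<in>UNIV. B1 x a \<beta> p * dx a f (lift x p)) + (\<Sum>a\<in>UNIV. B0 x a \<beta> p * dy a f (lift x p))"
    and dy_lift: "dy \<beta> (\<lambda>q. f (lift x q)) p = (\<Sum>a\<in>UNIV. B1 x a \<beta> p * dy a f (lift x p))"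
  using along_compose[OF smooth_on_imp_differentiable[OF f lift_in[OF p]]
      smooth_on_imp_differentiable[OF smooth_lift p]]
  by (simp_all add: dx_snd_lift[OF p] dy_snd_lift[OF p] fst_lift dx_x[OF p]
      dy_compose_fst[OF smooth_on_imp_differentiable[OF smooth_x_nth fst_S'[OF p]]])

section \<open>The restricted fundamental function as a Finsler function\<close>

abbreviation L' where "L' \<equiv> \<lambda>q. (F (lift x q))\<^sup>2"

lemma dy_L': "p \<in> S' \<Longrightarrow> dy \<beta> L' p = (\<Sum>b\<in>UNIV. B1 x b \<beta> p * dy b L (lift x p))"
  by (rule dy_lift[OF smooth_L])

text \<open>B does not depend on v, so each fibre derivative only brings out a factor B and no
  second derivatives of the immersion arise. The induced tensor is thereby a fibre Hessian, to which
  the theory of \<open>finsler_coord\<close> applies.\<close>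

lemma fund_tensor_lift:
  assumes p: "p \<in> S'"
  shows "fund_tensor (\<lambda>q. F (lift x q)) \<alpha> \<beta> p = induced_tensor F x \<alpha> \<beta> p"
proof -
  have "dy \<alpha> (dy \<beta> L') p = dy \<alpha> (\<lambda>q. \<Sum>b\<in>UNIV. B1 x b \<beta> q * dy b L (lift x q)) p"
    by (rule along_cong[OF open_S' p dy_L'])
  also have "\<dots> = (\<Sum>b\<in>UNIV. B1 x b \<beta> p * (\<Sum>a\<in>UNIV. B1 x a \<alpha> p * dy a (dy b L) (lift x p)))"
    by (simp add: along_sum along_mult smooth_on_imp_differentiable[OF smooth_B1 p]
        smooth_on_imp_differentiable[OF smooth_on_compose_lift[OF smooth_on_dy[OF smooth_L]] p]
        dy_B1[OF p] dy_lift[OF smooth_on_dy[OF smooth_L] p])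
  also have "\<dots> = 2 * induced_tensor F x \<alpha> \<beta> p"
    unfolding induced_tensor_def g_eq
    by (subst sum.swap) (simp add: sum_distrib_left mult_ac)
  finally show ?thesis by (simp add: fund_tensor_def)
qed

lemma lift_scale: "lift x (u, t *\<^sub>R v) = (fst (lift x (u, v)), t *\<^sub>R snd (lift x (u, v)))"
  by (simp add: lift_def matrix_vector_mult_scaleR)

text \<open>Definiteness on w is the ambient definiteness on the tangent vector z = B w, nonzero by
  injectivity of B; homogeneity holds because the lift is linear on the fibres.\<close>

sublocale sub: finsler_coord U' "\<lambda>p. F (lift x p)"
proof
  show "open U'" by (rule open_U')
  show "smooth_on (U' \<times> - {0}) (\<lambda>p. F (lift x p))"
    by (rule smooth_on_compose_lift[OF smooth_F])
  show "fibre_homogeneous 1 U' (\<lambda>p. F (lift x p))"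
    unfolding fibre_homogeneous_def lift_scale
  proof (intro ballI allI impI)
    fix u v and t :: real assume uv: "u \<in> U'" "v \<noteq> (0::real^'m)" and t: "0 < t"
    then have "lift x (u, v) \<in> S" by (intro lift_in) simp
    then show "F (fst (lift x (u, v)), t *\<^sub>R snd (lift x (u, v))) = t ^ 1 * F (lift x (u, v))"
      using fibre_homogeneousD[OF homogeneous_F, of "fst (lift x (u, v))" "snd (lift x (u, v))" t] t
      by (auto simp: mem_Times_iff)
  qed
  fix p :: "'m tcoord" and w :: "real^'m" assume p: "p \<in> U' \<times> - {0}" and w: "w \<noteq> 0"
  define z where "z = jacobian x (at (fst p)) *v w"
  have z: "z $ a = (\<Sum>\<alpha>\<in>UNIV. B1 x a \<alpha> p * w $ \<alpha>)" for a
    by (simp add: z_def B1_def matrix_vector_mult_def)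
  have "z \<noteq> 0" using immersive[OF fst_S'[OF p]] w by (auto simp: z_def)
  from positive[OF lift_in[OF p] this]
  have "0 < (\<Sum>a\<in>UNIV. \<Sum>b\<in>UNIV. \<Sum>\<alpha>\<in>UNIV. \<Sum>\<beta>\<in>UNIV.
      g a b (lift x p) * B1 x a \<alpha> p * B1 x b \<beta> p * w $ \<alpha> * w $ \<beta>)"
    by (simp add: z sum_distrib_left sum_distrib_right mult_ac)
  also have "\<dots> = (\<Sum>\<alpha>\<in>UNIV. \<Sum>\<beta>\<in>UNIV. \<Sum>a\<in>UNIV. \<Sum>b\<in>UNIV.
      g a b (lift x p) * B1 x a \<alpha> p * B1 x b \<beta> p * w $ \<alpha> * w $ \<beta>)"
    by (simp only: sum.cartesian_product, rule sum.reindex_bij_witness[of _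
        "\<lambda>(\<alpha>, \<beta>, a, b). (a, b, \<alpha>, \<beta>)" "\<lambda>(a, b, \<alpha>, \<beta>). (\<alpha>, \<beta>, a, b)"]) auto
  finally show "0 < (\<Sum>\<alpha>\<in>UNIV. \<Sum>\<beta>\<in>UNIV. fund_tensor (\<lambda>p. F (lift x p)) \<alpha> \<beta> p * w $ \<alpha> * w $ \<beta>)"
    by (simp add: fund_tensor_lift[OF p] induced_tensor_def sum_distrib_right)
qed

section \<open>The spray of the induced tensor and its fibre derivative\<close>

abbreviation gi where "gi \<equiv> induced_tensor F x"

lemma gi_spray: "p \<in> S' \<Longrightarrow> sub.G \<gamma> p = spray gi \<gamma> p"
  and gi_nlc: "p \<in> S' \<Longrightarrow> sub.N \<gamma> \<beta> p = intrinsic_nlc F x \<gamma> \<beta> p"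
  unfolding intrinsic_nlc_def
  by (rule cartan_nlc_cong[OF open_S' fund_tensor_lift]; assumption)+

lemma smooth_gi: "smooth_on S' (gi \<alpha> \<beta>)"
  by (rule smooth_on_cong[OF open_S' sub.smooth_g fund_tensor_lift])

lemma smooth_gi_spray: "smooth_on S' (spray gi \<alpha>)"
  by (rule smooth_on_cong[OF open_S' sub.smooth_spray gi_spray])

lemma smooth_intrinsic: "smooth_on S' (intrinsic_nlc F x \<alpha> \<beta>)"
  by (rule smooth_on_cong[OF open_S' sub.smooth_N gi_nlc])

lemma inv_gi: "p \<in> S' \<Longrightarrow> inv_tensor sub.g \<alpha> \<beta> p = inv_tensor gi \<alpha> \<beta> p"
  by (simp add: inv_tensor_def fund_tensor_lift)

lemma smooth_inv_gi: "smooth_on S' (inv_tensor gi \<alpha> \<beta>)"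
  by (rule smooth_on_cong[OF open_S' sub.smooth_inv inv_gi])

lemma solve_gi:
  assumes "p \<in> S'" "\<And>\<alpha>. (\<Sum>\<gamma>\<in>UNIV. gi \<alpha> \<gamma> p * X \<gamma>) = Y \<alpha>"
  shows "X \<alpha> = (\<Sum>\<gamma>\<in>UNIV. inv_tensor gi \<alpha> \<gamma> p * Y \<gamma>)"
  using sub.solve_g[of p X Y \<alpha>] assms by (simp add: fund_tensor_lift inv_gi)

text \<open>The function \<open>\<Phi>\<close> is the vector $G^c + \frac12 B^c_{\alpha\beta}v^\alpha v^\beta$ along the
  submanifold: the Euler--Lagrange expression of $F^2$, with its index raised, evaluated on the lift of
  a curve. Its tangential part is the intrinsic spray, its normal part is $\frac12 K_\gamma v^\gamma$.\<close>

definition \<Phi> :: "'n \<Rightarrow> 'm tcoord \<Rightarrow> real" where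
  "\<Phi> c q = G c (lift x q) + 1/2 * (\<Sum>\<beta>\<in>UNIV. B0 x c \<beta> q * snd q $ \<beta>)"

lemma smooth_\<Phi>: "smooth_on S' (\<Phi> c)"
  unfolding \<Phi>_def[abs_def]
  by (intro smooth_on_add smooth_on_mult smooth_on_sum smooth_on_const open_S' smooth_B0
      smooth_on_snd_nth smooth_on_compose_lift smooth_spray)

text \<open>\<open>lower_spray\<close> is used for the ambient and for the restricted function, and
  the chain rule compares them. The terms \<open>B0\<close> times \<open>dy b L\<close>, caused by
  the dependence of B on u, occur in the mixed derivative as well as in
  \<open>dx \<alpha> L'\<close> and cancel; what survives is contracted with \<open>B1\<close>, as
  befits a covector.\<close>

lemma lower_induced_spray:
  assumes p: "p \<in> S'"
  shows "(\<Sum>\<gamma>\<in>UNIV. gi \<alpha> \<gamma> p * spray gi \<gamma> p) =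
    (\<Sum>a\<in>UNIV. B1 x a \<alpha> p * (\<Sum>c\<in>UNIV. g a c (lift x p) * \<Phi> c p))"
proof -
  define l where "l = lift x p"
  define v where "v = snd p"
  define B00 where "B00 a = (\<Sum>\<gamma>\<in>UNIV. B0 x a \<gamma> p * v $ \<gamma>)" for a
  \<comment> \<open>P is the mixed derivative term of the ambient spray formula at the lifted point.
    Q is the extra contribution of the acceleration \<open>B00\<close>, its 2 coming from the fibre
    Hessian of L being 2 g.\<close>
  define P where "P b = (\<Sum>a\<in>UNIV. snd l $ a * dx a (dy b L) l)" for b
  define Q where "Q b = 2 * (\<Sum>a\<in>UNIV. g a b l * B00 a)" for b
  have l: "l \<in> S" unfolding l_def by (rule lift_in[OF p])
  have dd: "dx \<gamma> (dy \<alpha> L') p = (\<Sum>b\<in>UNIV. B2 x b \<gamma> \<alpha> p * dy b L l + B1 x b \<alpha> p *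
      ((\<Sum>a\<in>UNIV. B1 x a \<gamma> p * dx a (dy b L) l) + (\<Sum>a\<in>UNIV. B0 x a \<gamma> p * dy a (dy b L) l)))" for \<gamma>
  proof -
    have "dx \<gamma> (dy \<alpha> L') p = dx \<gamma> (\<lambda>q. \<Sum>b\<in>UNIV. B1 x b \<alpha> q * dy b L (lift x q)) p"
      by (rule along_cong[OF open_S' p dy_L'])
    then show ?thesis
      by (simp add: along_sum along_mult smooth_on_imp_differentiable[OF smooth_B1 p] B2_def l_def
          smooth_on_imp_differentiable[OF smooth_on_compose_lift[OF smooth_on_dy[OF smooth_L]] p]
          dx_lift[OF smooth_on_dy[OF smooth_L] p])
  qed
  have 1: "(\<Sum>\<gamma>\<in>UNIV. v $ \<gamma> * dx \<gamma> (dy \<alpha> L') p) =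
      (\<Sum>b\<in>UNIV. B0 x b \<alpha> p * dy b L l + B1 x b \<alpha> p * (P b + Q b))"
  proof -
    have B0: "B0 x b \<alpha> p = (\<Sum>\<gamma>\<in>UNIV. v $ \<gamma> * B2 x b \<gamma> \<alpha> p)" for b
      by (simp add: B0_def v_def mult.commute)
    have P: "P b = (\<Sum>\<gamma>\<in>UNIV. v $ \<gamma> * (\<Sum>a\<in>UNIV. B1 x a \<gamma> p * dx a (dy b L) l))" for b
      unfolding P_def l_def snd_lift v_def sum_distrib_left sum_distrib_right
      by (subst sum.swap) (simp add: mult_ac)
    have Q: "Q b = (\<Sum>\<gamma>\<in>UNIV. v $ \<gamma> * (\<Sum>a\<in>UNIV. B0 x a \<gamma> p * dy a (dy b L) l))" for b
      unfolding Q_def B00_def g_eq sum_distrib_left sum_distrib_right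
      by (subst sum.swap) (simp add: mult_ac)
    show ?thesis
      unfolding dd B0 P Q sum_distrib_left[of "v $ _"]
      by (subst sum.swap)
        (simp add: sum.distrib sum_distrib_left sum_distrib_right distrib_left mult_ac)
  qed
  have 2: "dx \<alpha> L' p = (\<Sum>b\<in>UNIV. B1 x b \<alpha> p * dx b L l) + (\<Sum>b\<in>UNIV. B0 x b \<alpha> p * dy b L l)"
    unfolding l_def by (rule dx_lift[OF smooth_L p])
  \<comment> \<open>The ambient formula gives 4 g G for P minus the base derivative, and Q = 2 g
    \<open>B00\<close> is 4 g applied to the second summand of \<Phi>.\<close>
  have 3: "P b + Q b - dx b L l = 4 * (\<Sum>c\<in>UNIV. g b c l * \<Phi> c p)" for b
  proof -
    have "Q b = 2 * (\<Sum>c\<in>UNIV. g b c l * B00 c)"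
      unfolding Q_def by (simp only: g_sym[OF l, of _ b])
    then show ?thesis
      using lower_spray[OF l, of b]
      by (simp add: \<Phi>_def P_def B00_def v_def l_def distrib_left sum.distrib sum_divide_distrib[symmetric])
  qed
  have "(\<Sum>\<gamma>\<in>UNIV. gi \<alpha> \<gamma> p * spray gi \<gamma> p) =
      1/4 * ((\<Sum>\<gamma>\<in>UNIV. v $ \<gamma> * dx \<gamma> (dy \<alpha> L') p) - dx \<alpha> L' p)"
    using sub.lower_spray[OF p, of \<alpha>] by (simp add: fund_tensor_lift[OF p] gi_spray[OF p] v_def)
  also have "\<dots> = 1/4 * (\<Sum>b\<in>UNIV. B1 x b \<alpha> p * (P b + Q b - dx b L l))"
    unfolding 1 2 by (simp add: sum.distrib sum_subtractf distrib_left right_diff_distrib)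
  finally show ?thesis
    unfolding 3 by (simp add: l_def sum_distrib_left)
qed

text \<open>By the symmetry of \<open>B2\<close> the quadratic form in v has fibre derivative 2
  \<open>B0\<close>, which the 1/2 in \<Phi> compensates; the chain rule turns the derivative of G
  into N contracted with B.\<close>

lemma dy_\<Phi>: assumes p: "p \<in> S'" shows "dy \<beta> (\<Phi> c) p = BN F x c \<beta> p"
proof -
  have "dy \<beta> (\<Phi> c) p = dy \<beta> (\<lambda>q. G c (lift x q)) p +
      dy \<beta> (\<lambda>q. 1/2 * (\<Sum>\<beta>\<in>UNIV. B0 x c \<beta> q * snd q $ \<beta>)) p"
    unfolding \<Phi>_def[abs_def]
    by (intro along_add smooth_on_imp_differentiable[OF _ p] smooth_on_mult smooth_on_sum
        smooth_on_const open_S' smooth_B0 smooth_on_snd_nth smooth_on_compose_lift smooth_spray)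
  also have "dy \<beta> (\<lambda>q. 1/2 * (\<Sum>\<beta>\<in>UNIV. B0 x c \<beta> q * snd q $ \<beta>)) p =
      1/2 * dy \<beta> (\<lambda>q. \<Sum>\<beta>\<in>UNIV. B0 x c \<beta> q * snd q $ \<beta>) p"
    by (intro along_cmult smooth_on_imp_differentiable[OF _ p] smooth_on_mult smooth_on_sum
        open_S' smooth_B0 smooth_on_snd_nth)
  also have "dy \<beta> (\<lambda>q. \<Sum>\<beta>\<in>UNIV. B0 x c \<beta> q * snd q $ \<beta>) p = 2 * B0 x c \<beta> p"
    by (simp add: along_sum along_mult smooth_on_imp_differentiable[OF smooth_B0 p]
        smooth_on_imp_differentiable[OF smooth_on_snd_nth p] dy_snd_nth dy_B0[OF p] sum.distrib
        sum_delta_mult B2_sym[OF p, of c \<beta>])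
      (simp add: B0_def)
  finally show ?thesis
    by (simp add: BN_def dy_lift[OF smooth_spray p] cartan_nlc_def mult.commute)
qed

lemma dy_g_lift:
  assumes p: "p \<in> S'"
  shows "dy \<beta> (\<lambda>q. g a c (lift x q)) p =
    2 * (\<Sum>d\<in>UNIV. B1 x d \<beta> p * cartan_tensor F a c d (lift x p))"
  by (simp add: dy_lift[OF smooth_g p] cartan_tensor_def sum_distrib_left)

text \<open>In view of \<open>dy_\<Phi>\<close> this is Euler's relation for \<Phi>, of degree 2 in
  v; it is obtained from the ambient relation \<open>N_y\<close>.\<close>

lemma BN_v: assumes p: "p \<in> S'" shows "(\<Sum>\<gamma>\<in>UNIV. BN F x c \<gamma> p * snd p $ \<gamma>) = 2 * \<Phi> c p"
proof -
  have "(\<Sum>\<gamma>\<in>UNIV. (\<Sum>b\<in>UNIV. N c b (lift x p) * B1 x b \<gamma> p) * snd p $ \<gamma>) =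
      (\<Sum>b\<in>UNIV. N c b (lift x p) * snd (lift x p) $ b)"
    unfolding snd_lift sum_distrib_left sum_distrib_right
    by (subst sum.swap) (simp only: mult.assoc)
  then show ?thesis
    by (simp add: BN_def distrib_right sum.distrib N_y[OF lift_in[OF p]] \<Phi>_def)
qed

text \<open>The product rule is applied to both sides of \<open>lower_induced_spray\<close>. The
  derivative of the induced tensor is that of g contracted with two factors B, so its term can be
  moved to the right and merged: the derivative of g then meets only \<Phi> minus the image under B
  of the intrinsic spray.\<close>

lemma differentiated_spray:
  assumes p: "p \<in> S'"
  shows "(\<Sum>\<gamma>\<in>UNIV. gi \<alpha> \<gamma> p * intrinsic_nlc F x \<gamma> \<beta> p) =
    (\<Sum>a\<in>UNIV. B1 x a \<alpha> p * (\<Sum>c\<in>UNIV. g a c (lift x p) * BN F x c \<beta> p)) +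
    (\<Sum>a\<in>UNIV. B1 x a \<alpha> p * (\<Sum>c\<in>UNIV. dy \<beta> (\<lambda>q. g a c (lift x q)) p *
      (\<Phi> c p - (\<Sum>\<gamma>\<in>UNIV. B1 x c \<gamma> p * spray gi \<gamma> p))))"
proof -
  note [simp] = along_sum along_mult smooth_on_imp_differentiable[OF smooth_B1 p]
    smooth_on_imp_differentiable[OF smooth_gi p] smooth_on_imp_differentiable[OF smooth_gi_spray p]
    smooth_on_imp_differentiable[OF smooth_\<Phi> p]
    smooth_on_imp_differentiable[OF smooth_on_compose_lift[OF smooth_g] p] dy_B1[OF p] dy_\<Phi>[OF p]
  define H where "H a c = dy \<beta> (\<lambda>q. g a c (lift x q)) p" for a c
  have dgi: "dy \<beta> (gi \<alpha> \<gamma>) p = (\<Sum>a\<in>UNIV. \<Sum>c\<in>UNIV. H a c * B1 x a \<alpha> p * B1 x c \<gamma> p)" for \<gamma>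
    unfolding induced_tensor_def[abs_def] by (simp add: H_def)
  have "dy \<beta> (\<lambda>q. \<Sum>\<gamma>\<in>UNIV. gi \<alpha> \<gamma> q * spray gi \<gamma> q) p =
      dy \<beta> (\<lambda>q. \<Sum>a\<in>UNIV. B1 x a \<alpha> q * (\<Sum>c\<in>UNIV. g a c (lift x q) * \<Phi> c q)) p"
    by (rule along_cong[OF open_S' p lower_induced_spray])
  then have "(\<Sum>\<gamma>\<in>UNIV. (\<Sum>a\<in>UNIV. \<Sum>c\<in>UNIV. H a c * B1 x a \<alpha> p * B1 x c \<gamma> p) * spray gi \<gamma> p) +
      (\<Sum>\<gamma>\<in>UNIV. gi \<alpha> \<gamma> p * intrinsic_nlc F x \<gamma> \<beta> p) =
      (\<Sum>a\<in>UNIV. B1 x a \<alpha> p * (\<Sum>c\<in>UNIV. H a c * \<Phi> c p + g a c (lift x p) * BN F x c \<beta> p))"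
    by (simp add: dgi sum.distrib H_def intrinsic_nlc_def cartan_nlc_def)
  moreover have "(\<Sum>\<gamma>\<in>UNIV. (\<Sum>a\<in>UNIV. \<Sum>c\<in>UNIV. H a c * B1 x a \<alpha> p * B1 x c \<gamma> p) * spray gi \<gamma> p) =
      (\<Sum>a\<in>UNIV. B1 x a \<alpha> p * (\<Sum>c\<in>UNIV. H a c * (\<Sum>\<gamma>\<in>UNIV. B1 x c \<gamma> p * spray gi \<gamma> p)))"
    unfolding sum_distrib_left sum_distrib_right
    by (subst sum.swap, rule sum.cong[OF refl], subst sum.swap) (simp add: mult_ac)
  ultimately show ?thesis
    by (simp add: H_def[symmetric] right_diff_distrib distrib_left sum.distrib sum_subtractf)
qed

end

section \<open>The induced and the intrinsic nonlinear connection\<close>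

locale framed_immersion = finsler_immersion U F U' x
  for U :: "(real^'n::finite) set" and F U' and x :: "real^'m::finite \<Rightarrow> real^'n" +
  fixes W :: "'m tcoord set" and E :: "'n \<Rightarrow> 'r::finite \<Rightarrow> 'm tcoord \<Rightarrow> real"
    and T :: "'m \<Rightarrow> 'n \<Rightarrow> 'm tcoord \<Rightarrow> real" and V :: "'r \<Rightarrow> 'n \<Rightarrow> 'm tcoord \<Rightarrow> real"
  assumes open_W: "open W" and W_sub: "W \<subseteq> S'" and frame: "moving_frame F x W E T V"
begin

lemma W_S': "p \<in> W \<Longrightarrow> p \<in> S'"
  using W_sub by blast

lemma
  assumes "p \<in> W"
  shows normal: "(\<Sum>a\<in>UNIV. \<Sum>b\<in>UNIV. g a b (lift x p) * B1 x a \<alpha> p * E b \<rho> p) = 0"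
    and complete: "(\<Sum>\<alpha>\<in>UNIV. B1 x a \<alpha> p * T \<alpha> b p) + (\<Sum>\<rho>\<in>UNIV. E a \<rho> p * V \<rho> b p) =
      (if a = b then 1 else 0)"
  using frame assms unfolding moving_frame_def by blast+

lemma decompose:
  assumes p: "p \<in> W"
  shows "Z c = (\<Sum>\<alpha>\<in>UNIV. B1 x c \<alpha> p * (\<Sum>b\<in>UNIV. T \<alpha> b p * Z b)) +
    (\<Sum>\<rho>\<in>UNIV. E c \<rho> p * (\<Sum>b\<in>UNIV. V \<rho> b p * Z b))"
proof -
  have "Z c = (\<Sum>b\<in>UNIV. (if c = b then 1 else 0) * Z b)"
    by (simp only: sum_delta_mult)
  also have "\<dots> = (\<Sum>b\<in>UNIV. \<Sum>\<alpha>\<in>UNIV. B1 x c \<alpha> p * T \<alpha> b p * Z b) +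
      (\<Sum>b\<in>UNIV. \<Sum>\<rho>\<in>UNIV. E c \<rho> p * V \<rho> b p * Z b)"
    by (simp only: complete[OF p, symmetric] distrib_right sum.distrib sum_distrib_right)
  also have "\<dots> = (\<Sum>\<alpha>\<in>UNIV. B1 x c \<alpha> p * (\<Sum>b\<in>UNIV. T \<alpha> b p * Z b)) +
      (\<Sum>\<rho>\<in>UNIV. E c \<rho> p * (\<Sum>b\<in>UNIV. V \<rho> b p * Z b))"
    by (subst (1 2) sum.swap) (simp only: sum_distrib_left mult.assoc)
  finally show ?thesis .
qed

text \<open>The g-product with a tangent vector kills the part of Z along E. This is where the
  normality of the frame enters.\<close>

lemma lower_tangential:
  assumes p: "p \<in> W"
  shows "(\<Sum>\<gamma>\<in>UNIV. gi \<alpha> \<gamma> p * (\<Sum>b\<in>UNIV. T \<gamma> b p * Z b)) =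
    (\<Sum>a\<in>UNIV. B1 x a \<alpha> p * (\<Sum>c\<in>UNIV. g a c (lift x p) * Z c))"
proof -
  define tz where "tz \<gamma> = (\<Sum>b\<in>UNIV. T \<gamma> b p * Z b)" for \<gamma>
  define vz where "vz \<rho> = (\<Sum>b\<in>UNIV. V \<rho> b p * Z b)" for \<rho>
  have "(\<Sum>a\<in>UNIV. B1 x a \<alpha> p * (\<Sum>c\<in>UNIV. g a c (lift x p) * Z c)) =
      (\<Sum>a\<in>UNIV. \<Sum>c\<in>UNIV. \<Sum>\<gamma>\<in>UNIV. g a c (lift x p) * B1 x a \<alpha> p * B1 x c \<gamma> p * tz \<gamma>) +
      (\<Sum>a\<in>UNIV. \<Sum>c\<in>UNIV. \<Sum>\<rho>\<in>UNIV. g a c (lift x p) * B1 x a \<alpha> p * E c \<rho> p * vz \<rho>)"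
    unfolding decompose[OF p, of Z, folded tz_def vz_def]
    by (simp add: distrib_left sum.distrib sum_distrib_left mult_ac)
  also have "\<dots> = (\<Sum>\<gamma>\<in>UNIV. \<Sum>a\<in>UNIV. \<Sum>c\<in>UNIV. g a c (lift x p) * B1 x a \<alpha> p * B1 x c \<gamma> p * tz \<gamma>) +
      (\<Sum>\<rho>\<in>UNIV. \<Sum>a\<in>UNIV. \<Sum>c\<in>UNIV. g a c (lift x p) * B1 x a \<alpha> p * E c \<rho> p * vz \<rho>)"
    by (intro arg_cong2[where f = plus] sum_rotate)
  also have "\<dots> = (\<Sum>\<gamma>\<in>UNIV. gi \<alpha> \<gamma> p * tz \<gamma>)"
    unfolding induced_tensor_def
    by (simp only: sum_distrib_right[symmetric] normal[OF p]) simp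
  finally show ?thesis by (simp add: tz_def)
qed

text \<open>With the b-th coordinate vector as Z, \<open>lower_tangential\<close> becomes a linear
  system for the b-components of T. Its solution involves only the metric and B, from which
  smoothness of T follows.\<close>

lemma T_eq:
  assumes p: "p \<in> W"
  shows "T \<alpha> b p = (\<Sum>\<gamma>\<in>UNIV. inv_tensor gi \<alpha> \<gamma> p * (\<Sum>a\<in>UNIV. B1 x a \<gamma> p * g a b (lift x p)))"
  by (rule solve_gi[OF W_S'[OF p]])
    (use lower_tangential[OF p, of _ "\<lambda>c. if b = c then 1 else 0"] in \<open>simp only: sum_delta_mult\<close>)

lemma smooth_T: "smooth_on W (T \<alpha> b)"
  by (rule smooth_on_cong[OF open_W _ T_eq[symmetric]])
    (intro smooth_on_sum smooth_on_mult open_W smooth_on_subset[OF _ W_sub] smooth_inv_gi smooth_B1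
      smooth_on_compose_lift smooth_g)

lemma smooth_induced_nlc: "smooth_on W (induced_nlc F x T \<alpha> \<beta>)"
  unfolding induced_nlc_def[abs_def] BN_def
  by (intro smooth_on_sum smooth_on_mult smooth_on_add open_W smooth_T smooth_on_subset[OF _ W_sub]
      smooth_B0 smooth_on_compose_lift smooth_N smooth_B1)

lemma intrinsic_eq_induced_add_deform:
  assumes p: "p \<in> W"
  shows "intrinsic_nlc F x \<alpha> \<beta> p = induced_nlc F x T \<alpha> \<beta> p + deform_D F x E V \<alpha> \<beta> p"
proof -
  have p': "p \<in> S'" by (rule W_S'[OF p])
  define l where "l = lift x p"
  \<comment> \<open>These are the normal components of \<Phi>; by \<open>BN_v\<close> they are half
    of K contracted with v.\<close>
  define w where "w \<rho> = (\<Sum>b\<in>UNIV. V \<rho> b p * \<Phi> b p)" for \<rho>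
  define H where "H a c = dy \<beta> (\<lambda>q. g a c (lift x q)) p" for a c
  define R where "R \<gamma> = (\<Sum>a\<in>UNIV. B1 x a \<gamma> p * (\<Sum>c\<in>UNIV. H a c * (\<Sum>\<rho>\<in>UNIV. E c \<rho> p * w \<rho>)))" for \<gamma>
  \<comment> \<open>The intrinsic spray and the tangential components of \<Phi> solve the same
    system with the invertible matrix \<open>gi\<close>, hence coincide. So only normal components
    remain in \<open>rest\<close>.\<close>
  have "spray gi \<gamma> p = (\<Sum>b\<in>UNIV. T \<gamma> b p * \<Phi> b p)" for \<gamma>
    unfolding solve_gi[OF p' lower_induced_spray[OF p']]
    by (rule solve_gi[OF p' lower_tangential[OF p], symmetric])
  then have rest: "\<Phi> c p - (\<Sum>\<gamma>\<in>UNIV. B1 x c \<gamma> p * spray gi \<gamma> p) = (\<Sum>\<rho>\<in>UNIV. E c \<rho> p * w \<rho>)" for c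
    using decompose[OF p, of "\<lambda>c. \<Phi> c p" c] by (simp add: w_def)
  have "(\<Sum>\<gamma>\<in>UNIV. gi \<alpha> \<gamma> p * (intrinsic_nlc F x \<gamma> \<beta> p - induced_nlc F x T \<gamma> \<beta> p)) = R \<alpha>" for \<alpha>
    using differentiated_spray[OF p', of \<alpha> \<beta>] lower_tangential[OF p, of \<alpha> "\<lambda>c. BN F x c \<beta> p"]
    by (simp add: rest R_def H_def induced_nlc_def right_diff_distrib sum_subtractf)
  from solve_gi[OF p' this, of \<alpha>]
  have diff: "intrinsic_nlc F x \<alpha> \<beta> p - induced_nlc F x T \<alpha> \<beta> p = (\<Sum>\<gamma>\<in>UNIV. inv_tensor gi \<alpha> \<gamma> p * R \<gamma>)" .
  have K: "(\<Sum>\<gamma>\<in>UNIV. normal_K F x V \<rho> \<gamma> p * snd p $ \<gamma>) = 2 * w \<rho>" for \<rho>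
  proof -
    have "(\<Sum>\<gamma>\<in>UNIV. normal_K F x V \<rho> \<gamma> p * snd p $ \<gamma>) =
        (\<Sum>a\<in>UNIV. V \<rho> a p * (\<Sum>\<gamma>\<in>UNIV. BN F x a \<gamma> p * snd p $ \<gamma>))"
      unfolding normal_K_def sum_distrib_left sum_distrib_right
      by (subst sum.swap) (simp only: mult.assoc)
    then show ?thesis
      by (simp only: BN_v[OF p']) (simp add: w_def sum_distrib_left mult_ac)
  qed
  \<comment> \<open>\<open>mixed_g\<close> has the normal index in the first slot, while H is
    contracted with the tangent vector there; the symmetry of g exchanges the two.\<close>
  have C: "cartan_tensor F a b d l = cartan_tensor F b a d l" for a b d
    unfolding cartan_tensor_def
    using along_cong[OF open_S lift_in[OF p'] g_sym] by (simp add: l_def)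
  have "deform_D F x E V \<alpha> \<beta> p = (\<Sum>\<rho>\<in>UNIV. mixed_g F x E \<rho> \<alpha> \<beta> p * (2 * w \<rho>))"
    unfolding deform_D_def K[symmetric] by (simp add: sum_distrib_left mult.assoc)
  \<comment> \<open>The 2 in front of w is absorbed into H, which is twice the contracted Cartan
    tensor.\<close>
  also have "\<dots> = (\<Sum>\<rho>\<in>UNIV. \<Sum>\<gamma>\<in>UNIV. \<Sum>c\<in>UNIV. \<Sum>a\<in>UNIV.
      inv_tensor gi \<alpha> \<gamma> p * B1 x a \<gamma> p * H a c * E c \<rho> p * w \<rho>)"
    unfolding mixed_g_def H_def dy_g_lift[OF p'] l_def[symmetric]
    by (subst C) (simp add: sum_distrib_left sum_distrib_right mult_ac)
  also have "\<dots> = (\<Sum>\<gamma>\<in>UNIV. \<Sum>a\<in>UNIV. \<Sum>c\<in>UNIV. \<Sum>\<rho>\<in>UNIV.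
      inv_tensor gi \<alpha> \<gamma> p * B1 x a \<gamma> p * H a c * E c \<rho> p * w \<rho>)"
  proof -
    have "(\<Sum>\<rho>\<in>UNIV. \<Sum>\<gamma>\<in>UNIV. \<Sum>c\<in>UNIV. \<Sum>a\<in>UNIV. f \<rho> \<gamma> c a) =
        (\<Sum>\<gamma>\<in>UNIV. \<Sum>a\<in>UNIV. \<Sum>c\<in>UNIV. \<Sum>\<rho>\<in>UNIV. f \<rho> \<gamma> c a)"
      for f :: "'r \<Rightarrow> 'm \<Rightarrow> 'n \<Rightarrow> 'n \<Rightarrow> real"
    proof -
      have "(\<Sum>\<rho>\<in>UNIV. \<Sum>\<gamma>\<in>UNIV. \<Sum>c\<in>UNIV. \<Sum>a\<in>UNIV. f \<rho> \<gamma> c a) =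
          (\<Sum>\<gamma>\<in>UNIV. \<Sum>\<rho>\<in>UNIV. \<Sum>a\<in>UNIV. \<Sum>c\<in>UNIV. f \<rho> \<gamma> c a)"
        by (rule trans[OF sum.swap], rule sum.cong[OF refl], rule sum.cong[OF refl], rule sum.swap)
      also have "\<dots> = (\<Sum>\<gamma>\<in>UNIV. \<Sum>a\<in>UNIV. \<Sum>\<rho>\<in>UNIV. \<Sum>c\<in>UNIV. f \<rho> \<gamma> c a)"
        by (rule sum.cong[OF refl], rule sum.swap)
      also have "\<dots> = (\<Sum>\<gamma>\<in>UNIV. \<Sum>a\<in>UNIV. \<Sum>c\<in>UNIV. \<Sum>\<rho>\<in>UNIV. f \<rho> \<gamma> c a)"
        by (rule sum.cong[OF refl], rule sum.cong[OF refl], rule sum.swap)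
      finally show ?thesis .
    qed
    then show ?thesis by simp
  qed
  also have "\<dots> = (\<Sum>\<gamma>\<in>UNIV. inv_tensor gi \<alpha> \<gamma> p * R \<gamma>)"
    by (simp add: R_def sum_distrib_left mult_ac)
  finally show ?thesis using diff by simp
qed

end

section \<open>Adapted bases and their brackets under a deformation\<close>

lemma adapted_h_deform:
  assumes "\<And>\<alpha> \<beta>. No \<alpha> \<beta> p = Nc \<alpha> \<beta> p + D \<alpha> \<beta> p"
  shows "adapted_h No \<alpha> p = adapted_h Nc \<alpha> p - (\<Sum>\<beta>\<in>UNIV. D \<beta> \<alpha> p *\<^sub>R adapted_v Nc \<beta> p)"
  by (simp add: adapted_h_def adapted_v_def assms scaleR_left_distrib sum.distrib algebra_simps)

text \<open>The change of the coefficients contributes the derivatives of D along the old basis, the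
  change of the basis the products of D with fibre derivatives of Nc + D, that is, of No.\<close>

lemma bracket_deform:
  fixes No Nc D :: "'m::finite \<Rightarrow> 'm \<Rightarrow> 'm tcoord \<Rightarrow> real"
  assumes W: "open W" "p \<in> W"
    and eq: "\<And>\<alpha> \<beta> q. q \<in> W \<Longrightarrow> No \<alpha> \<beta> q = Nc \<alpha> \<beta> q + D \<alpha> \<beta> q"
    and No: "\<And>\<alpha> \<beta>. No \<alpha> \<beta> differentiable at p" and Nc: "\<And>\<alpha> \<beta>. Nc \<alpha> \<beta> differentiable at p"
  shows "bracket_R No \<alpha> \<beta> \<gamma> p = bracket_R Nc \<alpha> \<beta> \<gamma> p + D00 Nc D \<alpha> \<beta> \<gamma> p"
    and "bracket_B No \<alpha> \<beta> \<gamma> p = bracket_B Nc \<alpha> \<beta> \<gamma> p + D01 Nc D \<alpha> \<beta> \<gamma> p"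
proof -
  \<comment> \<open>D agrees on the open set W with a difference of functions differentiable at p,
    which determines its derivatives there.\<close>
  have D: "along X (D \<alpha> \<beta>) p = along X (No \<alpha> \<beta>) p - along X (Nc \<alpha> \<beta>) p" for X \<alpha> \<beta>
    using along_cong[OF W, of "D \<alpha> \<beta>" "\<lambda>q. No \<alpha> \<beta> q - Nc \<alpha> \<beta> q"] along_diff[OF No Nc]
    by (simp add: eq)
  have ND: "along X (\<lambda>q. Nc \<alpha> \<beta> q + D \<alpha> \<beta> q) p = along X (No \<alpha> \<beta>) p" for X \<alpha> \<beta>
    by (rule along_cong[OF W]) (simp add: eq)
  have h: "along (adapted_h No \<gamma>) (No \<alpha> \<beta>) p = along (adapted_h Nc \<gamma>) (No \<alpha> \<beta>) p -
      (\<Sum>\<delta>\<in>UNIV. D \<delta> \<gamma> p * along (adapted_v Nc \<delta>) (No \<alpha> \<beta>) p)" for \<alpha> \<beta> \<gamma>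
  proof -
    have lin: "linear (frechet_derivative (No \<alpha> \<beta>) (at p))"
      by (rule linear_frechet_derivative[OF No])
    show ?thesis
      unfolding along_def adapted_h_deform[of No p Nc D, OF eq[OF W(2)]]
      by (simp only: linear_diff[OF lin] linear_sum[OF lin] linear_cmul[OF lin] real_scaleR_def)
  qed
  show "bracket_R No \<alpha> \<beta> \<gamma> p = bracket_R Nc \<alpha> \<beta> \<gamma> p + D00 Nc D \<alpha> \<beta> \<gamma> p"
    by (simp add: bracket_R_def D00_def h D ND)
  show "bracket_B No \<alpha> \<beta> \<gamma> p = bracket_B Nc \<alpha> \<beta> \<gamma> p + D01 Nc D \<alpha> \<beta> \<gamma> p"
    by (simp add: bracket_B_def D01_def D adapted_v_def)
qed

theorem proposition3p2:
  fixes A :: "('p::{t2_space,second_countable_topology}, 'n::finite) chart set"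
    and F :: "('p, 'n) chart \<Rightarrow> 'n tcoord \<Rightarrow> real"
    and A' :: "('q::{t2_space,second_countable_topology}, 'm::finite) chart set"
    and i :: "'q \<Rightarrow> 'p"
    and c :: "('q, 'm) chart" and d :: "('p, 'n) chart"
    and x :: "real^'m \<Rightarrow> real^'n"
    and W :: "'m tcoord set"
    and E :: "'n \<Rightarrow> 'r::finite \<Rightarrow> 'm tcoord \<Rightarrow> real"
    and T :: "'m \<Rightarrow> 'n \<Rightarrow> 'm tcoord \<Rightarrow> real"
    and V :: "'r \<Rightarrow> 'n \<Rightarrow> 'm tcoord \<Rightarrow> real"
    and No Nc D :: "'m \<Rightarrow> 'm \<Rightarrow> 'm tcoord \<Rightarrow> real"
  assumes dims: "1 < CARD('m)" "CARD('m) < CARD('n)" "CARD('r) = CARD('n) - CARD('m)"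
    and finsler: "finsler_space A F"
    and submanifold: "smooth_atlas A'" "immersion A' A i"
    and charts: "c \<in> A'" "d \<in> A" "x = coord_rep c d i"
    and W: "open W" "W \<subseteq> coord_dom c d i \<times> (- {0})"
    and frame: "moving_frame (F d) x W E T V"
    and intrinsic: "No = intrinsic_nlc (F d) x"
    and induced: "Nc = induced_nlc (F d) x T"
    and D: "D = deform_D (F d) x E V"
  shows "\<forall>p\<in>W.
      (\<forall>\<alpha> \<beta>. No \<alpha> \<beta> p = Nc \<alpha> \<beta> p + D \<alpha> \<beta> p) \<and>
      (\<forall>\<alpha>. adapted_h No \<alpha> p = adapted_h Nc \<alpha> p - (\<Sum>\<beta>\<in>UNIV. D \<beta> \<alpha> p *\<^sub>R adapted_v Nc \<beta> p)) \<and>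
      (\<forall>\<alpha>. adapted_v No \<alpha> p = adapted_v Nc \<alpha> p) \<and>
      (\<forall>\<alpha> \<beta> \<gamma>. bracket_R No \<alpha> \<beta> \<gamma> p = bracket_R Nc \<alpha> \<beta> \<gamma> p + D00 Nc D \<alpha> \<beta> \<gamma> p) \<and>
      (\<forall>\<alpha> \<beta> \<gamma>. bracket_B No \<alpha> \<beta> \<gamma> p = bracket_B Nc \<alpha> \<beta> \<gamma> p + D01 Nc D \<alpha> \<beta> \<gamma> p)"
proof -
  \<comment> \<open>The base projection of W serves as the coordinate domain on the submanifold:
    projections are open maps, so it is open, and it lies in the domain of the coordinate expression
    x.\<close>
  let ?U = "snd d ` fst d" and ?U' = "fst ` W"
  have Fd: "smooth_on (?U \<times> -{0}) (F d)" "\<And>z y t. z \<in> ?U \<Longrightarrow> 0 < t \<Longrightarrow> F d (z, t *\<^sub>R y) = t * F d (z, y)"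
    "\<And>z y w. z \<in> ?U \<Longrightarrow> y \<noteq> 0 \<Longrightarrow> w \<noteq> 0 \<Longrightarrow>
      (\<Sum>a\<in>UNIV. \<Sum>b\<in>UNIV. fund_tensor (F d) a b (z, y) * w $ a * w $ b) > 0"
    using finsler charts(2) unfolding finsler_space_def by blast+
  have U: "open ?U"
    using finsler charts(2) unfolding finsler_space_def smooth_atlas_def by blast
  have hom: "fibre_homogeneous 1 ?U (F d)"
    using Fd(2) by (simp add: fibre_homogeneous_def)
  have pos: "(\<Sum>a\<in>UNIV. \<Sum>b\<in>UNIV. fund_tensor (F d) a b p * w $ a * w $ b) > 0"
    if "p \<in> ?U \<times> -{0}" "w \<noteq> 0" for p w
    using Fd(3)[of "fst p" "snd p" w] that by (simp add: mem_Times_iff)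
  have U': "open ?U'" by (rule open_image_fst[OF W(1)])
  have dom: "?U' \<subseteq> coord_dom c d i" using W(2) by auto
  have x: "smooth_on ?U' x" "\<And>u. u \<in> ?U' \<Longrightarrow> rank (jacobian x (at u)) = CARD('m)"
    using submanifold(2) charts dom smooth_on_subset
    unfolding immersion_def by blast+
  \<comment> \<open>A matrix whose rank equals its number of columns is injective, the form of the
    immersion condition used in the locale.\<close>
  have inj: "w = 0" if "u \<in> ?U'" "jacobian x (at u) *v w = 0" for u w
    using x(2)[OF that(1)] that(2) full_rank_injective[of "jacobian x (at u)"]
    by (metis injD matrix_vector_mult_0_right)
  have img: "x ` ?U' \<subseteq> ?U"
  proof
    fix z assume "z \<in> x ` ?U'"
    then obtain q where q: "q \<in> fst c" "i q \<in> fst d" "z = x (snd c q)"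
      using dom by (auto simp: coord_dom_def)
    have "inv_into (fst c) (snd c) (snd c q) = q"
      using submanifold(1) charts(1) q(1) unfolding smooth_atlas_def homeomorphism_def by blast
    then show "z \<in> ?U" using q charts(3) by (auto simp: coord_rep_def)
  qed
  have sub: "W \<subseteq> ?U' \<times> -{0}" using W(2) by force
  interpret framed_immersion ?U "F d" ?U' x W E T V
    by unfold_locales (use U Fd(1) hom pos U' x(1) img inj W(1) sub frame in blast)+
  have eq: "No \<alpha> \<beta> q = Nc \<alpha> \<beta> q + D \<alpha> \<beta> q" if "q \<in> W" for \<alpha> \<beta> q
    unfolding intrinsic induced D by (rule intrinsic_eq_induced_add_deform[OF that])
  show ?thesis
  proof (intro ballI conjI allI)
    fix p \<alpha> \<beta> \<gamma> assume p: "p \<in> W"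
    have No: "No \<alpha> \<beta> differentiable at p" and Nc: "Nc \<alpha> \<beta> differentiable at p" for \<alpha> \<beta>
      unfolding intrinsic induced
      by (rule smooth_on_imp_differentiable[OF smooth_intrinsic W_S'[OF p]],
          rule smooth_on_imp_differentiable[OF smooth_induced_nlc p])
    show "No \<alpha> \<beta> p = Nc \<alpha> \<beta> p + D \<alpha> \<beta> p" by (rule eq[OF p])
    show "adapted_h No \<alpha> p = adapted_h Nc \<alpha> p - (\<Sum>\<beta>\<in>UNIV. D \<beta> \<alpha> p *\<^sub>R adapted_v Nc \<beta> p)"
      by (rule adapted_h_deform) (rule eq[OF p])
    show "adapted_v No \<alpha> p = adapted_v Nc \<alpha> p" by (simp add: adapted_v_def)
    show "bracket_R No \<alpha> \<beta> \<gamma> p = bracket_R Nc \<alpha> \<beta> \<gamma> p + D00 Nc D \<alpha> \<beta> \<gamma> p"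
      and "bracket_B No \<alpha> \<beta> \<gamma> p = bracket_B Nc \<alpha> \<beta> \<gamma> p + D01 Nc D \<alpha> \<beta> \<gamma> p"
      by (rule bracket_deform[OF W(1) p eq No Nc]; assumption)+
  qed
qed

end
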